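(* There exists an FIID labeling $\Theta\in[0,1]^{V(\mathbb{T}_3)}$ of the $3$-regular tree $\mathbb{T}_3$ whose marginals are uniform on $[0,1]$ and for which, almost surely, $\mathsf{clust}(\Theta)$ contains infinite clusters.
   Context: $\mathbb{T}_3$ is the infinite $3$-regular tree, regarded as a (right) Cayley graph of a countable group $\Gamma$ (for example $\Gamma=\mathbb{Z}/2*\mathbb{Z}/2*\mathbb{Z}/2$ with its three standard generators), so $V(\mathbb{T}_3)=\Gamma$ and $\Gamma$ acts on $\mathbb{T}_3$ by left multiplication. FIID (factor of i.i.d.): for a measurable label space $S$, $\Gamma$ acts on $S^\Gamma$ by $(\gamma\cdot L)(\delta)=L(\gamma^{-1}\delta)$. An FIID labeling is a random element $\Theta=f(\omega)$ of $S^\Gamma$, where $\omega=\{\omega_\gamma\}_{\gamma\in\Gamma}$ is an i.i.d. family of uniform $[0,1]$ random variables and $f:[0,1]^\Gamma\to S^\Gamma$ is a measurable $\Gamma$-equivariant map. The marginal of $\Theta$ is the distribution of $\Theta(\gamma)$, which does not depend on $\gamma\in\Gamma$. For a labeling $\mathcal{L}$ of the vertices of a graph, $\mathsf{clust}(\mathcal{L})$ is the (spanning) subgraph obtained by deleting every edge whose endpoints have different $\mathcal{L}$-labels; its connected components are called clusters. *)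

theory Defs
  imports
    "HOL-Probability.Probability"
    "HOL-Algebra.Group"
    "Graph_Theory.Graph_Theory"
begin

text \<open>
  Undirected graphs are symmetric loop-free digraphs whose arcs are pairs of vertices.
  The right Cayley graph joins \<open>g\<close> and \<open>g s\<close> for every generator \<open>s\<close>, in both directions,
  so \<open>A\<close> need not be closed under inverses (as for the generators \<open>a, b\<close> of
  \<open>\<int> * \<int>/2\<close>, which also give the \<open>3\<close>-regular tree). Left multiplications are automorphisms.
\<close>

definition cayley_graph :: "('g, 'm) monoid_scheme \<Rightarrow> 'g set \<Rightarrow> 'g pair_pre_digraph" where
  "cayley_graph G A =
     \<lparr> pverts = carrier G,
       parcs = {(g, h). g \<in> carrier G \<and> h \<in> carrier G \<and>
                        (\<exists>s\<in>A. h = g \<otimes>\<^bsub>G\<^esub> s \<or> g = h \<otimes>\<^bsub>G\<^esub> s)} \<rparr>"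

text \<open>
  The library predicates \<^const>\<open>forest\<close> and \<^const>\<open>tree\<close> count the back-and-forth walk
  \<open>a, b, a\<close> along a symmetric pair of arcs as a cycle, so no symmetric digraph with an arc
  satisfies them. A cycle of an undirected graph is a cycle of length at least \<open>3\<close>.
\<close>

definition regular_tree :: "nat \<Rightarrow> 'v pair_pre_digraph \<Rightarrow> bool" where
  "regular_tree d T \<longleftrightarrow>
     pair_bidirected_digraph T \<and>
     connected (with_proj T) \<and>
     (\<nexists>p. pre_digraph.cycle (with_proj T) p \<and> 3 \<le> length p) \<and>
     (\<forall>v\<in>pverts T. out_degree (with_proj T) v = d)"

definition clust :: "'v pair_pre_digraph \<Rightarrow> ('v \<Rightarrow> 's) \<Rightarrow> 'v pair_pre_digraph" where
  "clust T L = \<lparr> pverts = pverts T, parcs = {(u, v) \<in> parcs T. L u = L v} \<rparr>"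

text \<open>For a symmetric digraph the strongly connected components are the connected components.\<close>

definition clusters :: "'v pair_pre_digraph \<Rightarrow> ('v \<Rightarrow> 's) \<Rightarrow> ('v, 'v \<times> 'v) pre_digraph set" where
  "clusters T L = pre_digraph.sccs (with_proj (clust T L))"

text \<open>
  The measurable space \<open>[0,1]\<close> and the uniform distribution on it; both have underlying set
  \<open>{0..1}\<close>, not the whole real line.
\<close>

definition unit_borel :: "real measure" where
  "unit_borel = restrict_space borel {0..1}"

definition unit_uniform :: "real measure" where
  "unit_uniform = restrict_space lborel {0..1}"

text \<open>
  The law of the i.i.d. uniform family \<open>\<omega>\<close>. It serves as the canonical probability space on which
  \<open>\<omega>\<close> is the identity, so the random labeling \<open>f(\<omega>)\<close> is the factor map \<open>f\<close> itself.
\<close>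

definition iid_uniform :: "('g, 'm) monoid_scheme \<Rightarrow> ('g \<Rightarrow> real) measure" where
  "iid_uniform G = (\<Pi>\<^sub>M \<gamma>\<in>carrier G. unit_uniform)"

definition shift :: "('g, 'm) monoid_scheme \<Rightarrow> 'g \<Rightarrow> ('g \<Rightarrow> 's) \<Rightarrow> 'g \<Rightarrow> 's" where
  "shift G \<gamma> L = (\<lambda>\<delta>\<in>carrier G. L (inv\<^bsub>G\<^esub> \<gamma> \<otimes>\<^bsub>G\<^esub> \<delta>))"

definition FIID_labeling ::
  "('g, 'm) monoid_scheme \<Rightarrow> 's measure \<Rightarrow> (('g \<Rightarrow> real) \<Rightarrow> 'g \<Rightarrow> 's) \<Rightarrow> bool" where
  "FIID_labeling G S f \<longleftrightarrow>
     f \<in> iid_uniform G \<rightarrow>\<^sub>M (\<Pi>\<^sub>M \<gamma>\<in>carrier G. S) \<and>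
     (\<forall>\<gamma>\<in>carrier G. \<forall>\<omega>\<in>space (iid_uniform G). f (shift G \<gamma> \<omega>) = shift G \<gamma> (f \<omega>))"

definition marginal ::
  "('g, 'm) monoid_scheme \<Rightarrow> 's measure \<Rightarrow> (('g \<Rightarrow> real) \<Rightarrow> 'g \<Rightarrow> 's) \<Rightarrow> 'g \<Rightarrow> 's measure" where
  "marginal G S f \<gamma> = distr (iid_uniform G) S (\<lambda>\<omega>. f \<omega> \<gamma>)"

end

theory Submission
  imports Defs
begin

text \<open>
  Give every vertex independent fair coins. They select random sets of vertices, the levels
  \<open>0, 1, 2, \<dots>\<close>, of rapidly decreasing densities, and an infinite string of label digits for each
  vertex and level. A vertex \<open>x\<close> used at level \<open>k\<close> is joined by a path of length about \<open>r\<^sub>k\<close> to a vertex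
  of level \<open>k + 1\<close> whose label agrees with that of \<open>x\<close> in the first \<open>k\<close> digits. Continuing, one gets an
  infinite chain of paths along which the labels converge, and the limit is given to all vertices
  on it. With \<open>r\<^sub>k\<close> growing like \<open>4\<^sup>k\<close> and densities \<open>2\<close> to the power \<open>- r\<^sub>k + O(k)\<close>, a union bound shows
  that a chain started at level \<open>n\<close> succeeds with probability \<open>1 - O(2\<close> to the power \<open>- n)\<close>, where failure
  means that no partner is found or that the chain meets a foreign path of the same or a higher
  level. Hence successful chains exist almost surely, and their vertices lie in infinite clusters.
  Flipping all label digits at a fixed set of positions preserves the law of the coins and flips
  the same digits of the final label, so the digits of the latter are again fair coins.
\<close>

section \<open>Fair coins and binary digits\<close>

text \<open>A chain moves in a way that depends on the very coins to be inspected next, so its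
  position cannot be treated as given. Instead of conditioning, each failure is bounded at all of
  the at most \<open>2 ^ scale_sum k\<close> vertices where a chain started at \<open>\<one>\<close>
  can stand on level \<open>k\<close>. This is affordable because the factor four between scales
  makes \<open>scale k\<close> exceed \<open>3 * scale_sum k\<close>. A miss has probability at most
  \<open>(1/2) ^ scale k\<close>. For a clash with a path of level \<open>m\<close>, the four
  vertices involved are named by about \<open>scale_sum k + scale k + scale m\<close> bits, while
  their levels cost about \<open>scale (k - 1) + scale k + scale (m - 1) + scale m\<close> bits, up
  to linear terms.

  Chains may merge, since one vertex can be the partner of many. Merging is not counted as a
  failure, because the merged chains have a common tail and hence the same limit label.

  Uniformity of the final label is not inherited from single coins, because the search for partners
  inspects label digits and biases the vertices it selects. But it only asks whether digits of two
  vertices agree, and so does not notice when the digits of all vertices are flipped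
  together.\<close>

definition coins :: "'i set \<Rightarrow> ('i \<Rightarrow> bool) measure" where
  "coins I = (\<Pi>\<^sub>M i\<in>I. measure_pmf (bernoulli_pmf (1/2)))"

interpretation coin: product_prob_space "\<lambda>_. measure_pmf (bernoulli_pmf (1/2))" I for I :: "'i set"
  by unfold_locales

lemma prob_space_coins: "prob_space (coins I)"
  unfolding coins_def by (rule coin.P.prob_space_axioms)

lemma space_coins: "space (coins I) = (\<Pi>\<^sub>E i\<in>I. UNIV)"
  by (simp add: coins_def space_PiM)

lemma measurable_coins_component [measurable (raw)]:
  "i \<in> I \<Longrightarrow> Measurable.pred (coins I) (\<lambda>b. b i)"
  unfolding coins_def
  by (subst measurable_cong_sets[OF refl, where N' = "measure_pmf (bernoulli_pmf (1/2))"])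
    (auto intro: measurable_component_singleton)

lemma pred_cylinder:
  assumes "finite J" "J \<subseteq> I"
  shows "Measurable.pred (coins I) (\<lambda>b. \<forall>i\<in>J. b i = c i)"
proof (rule pred_intros_finite(3)[OF assms(1)])
  fix i assume "i \<in> J"
  then have [measurable]: "Measurable.pred (coins I) (\<lambda>b. b i)"
    using assms(2) by (intro measurable_coins_component) auto
  show "Measurable.pred (coins I) (\<lambda>b. b i = c i)" by measurable
qed

lemma measurable_coinsI:
  assumes "\<And>i. i \<in> I \<Longrightarrow> Measurable.pred M (\<lambda>x. f x i)"
    and "\<And>x. x \<in> space M \<Longrightarrow> f x \<in> extensional I"
  shows "f \<in> M \<rightarrow>\<^sub>M coins I"
  unfolding coins_def
proof (rule measurable_PiM_single)
  show "f \<in> space M \<rightarrow> (\<Pi>\<^sub>E i\<in>I. space (measure_pmf (bernoulli_pmf (1/2))))"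
    using assms(2) by (auto simp: PiE_def)
next
  fix A :: "bool set" and i
  assume "i \<in> I"
  then have "(\<lambda>x. f x i) \<in> M \<rightarrow>\<^sub>M count_space UNIV" by (rule assms(1))
  then have "(\<lambda>x. f x i) -` A \<inter> space M \<in> sets M"
    by (rule measurable_sets) simp
  also have "(\<lambda>x. f x i) -` A \<inter> space M = {\<omega> \<in> space M. f \<omega> i \<in> A}" by auto
  finally show "{\<omega> \<in> space M. f \<omega> i \<in> A} \<in> sets M" .
qed

lemma measure_coin_singleton: "measure (measure_pmf (bernoulli_pmf (1/2))) {x} = 1/2"
  by (cases x) (simp_all add: measure_pmf_single)

lemma measure_coins_cylinder:
  assumes "finite J" "J \<subseteq> I"
  shows "measure (coins I) {b \<in> space (coins I). \<forall>i\<in>J. b i = c i} = (1/2) ^ card J"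
proof -
  have "{b \<in> space (coins I). \<forall>i\<in>J. b i = c i}
      = prod_emb I (\<lambda>_. measure_pmf (bernoulli_pmf (1/2))) J (\<Pi>\<^sub>E i\<in>J. {c i})"
    using assms by (auto simp: space_coins prod_emb_def PiE_def Pi_def)
  then have "measure (coins I) {b \<in> space (coins I). \<forall>i\<in>J. b i = c i}
      = (\<Prod>i\<in>J. measure (measure_pmf (bernoulli_pmf (1/2))) {c i})"
    using coin.measure_PiM_emb[of J I "\<lambda>i. {c i}"] assms by (simp add: coins_def)
  also have "\<dots> = (\<Prod>i\<in>J. 1/2)"
    by (intro prod.cong refl measure_coin_singleton)
  finally show ?thesis by simp
qed

text \<open>A coordinate has only two values, so a finite-dimensional rectangle is a finite disjoint
  union of cylinders with prescribed values. The laws of binary digits, encoded coins, flipped coins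
  and labels are all identified by this criterion.\<close>

lemma coins_eqI:
  assumes "prob_space P" and sets: "sets P = sets (coins I)"
    and cyl: "\<And>J c. finite J \<Longrightarrow> J \<subseteq> I \<Longrightarrow>
      measure P {b \<in> space P. \<forall>i\<in>J. b i = c i} = (1/2) ^ card J"
  shows "P = coins I"
proof -
  interpret P: prob_space P by fact
  let ?C = "\<lambda>_. measure_pmf (bernoulli_pmf (1/2))"
  have space: "space P = (\<Pi>\<^sub>E i\<in>I. UNIV)"
    using sets_eq_imp_space_eq[OF sets] by (simp add: space_coins)
  show ?thesis
    unfolding coins_def
  proof (rule coin.PiM_eq)
    show "sets P = sets (PiM I ?C)" using sets by (simp add: coins_def)
  next
    fix J :: "'a set" and F :: "'a \<Rightarrow> bool set"
    assume J: "finite J" "J \<subseteq> I"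
    let ?E = "\<lambda>c. {b \<in> space P. \<forall>i\<in>J. b i = c i}"
    have meas: "?E c \<in> sets P" for c
    proof -
      have "{b \<in> space (coins I). \<forall>i\<in>J. b i = c i} \<in> sets (coins I)"
        using pred_cylinder[OF J] by (simp add: pred_def)
      then show ?thesis
        using sets sets_eq_imp_space_eq[OF sets] by simp
    qed
    have fin: "finite (\<Pi>\<^sub>E i\<in>J. F i)"
      using J by (intro finite_PiE) auto
    have "prod_emb I ?C J (\<Pi>\<^sub>E i\<in>J. F i) = (\<Union>c\<in>(\<Pi>\<^sub>E i\<in>J. F i). ?E c)" (is "?L = ?R")
    proof
      show "?L \<subseteq> ?R"
      proof
        fix b assume b: "b \<in> ?L"
        then have "restrict b J \<in> (\<Pi>\<^sub>E i\<in>J. F i)" "b \<in> space P"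
          by (auto simp: prod_emb_def space)
        then show "b \<in> ?R" by (intro UN_I[of "restrict b J"]) auto
      qed
      show "?R \<subseteq> ?L"
        by (auto simp: prod_emb_def space PiE_def Pi_def)
    qed
    moreover have "P.prob (\<Union>c\<in>(\<Pi>\<^sub>E i\<in>J. F i). ?E c) = (\<Sum>c\<in>(\<Pi>\<^sub>E i\<in>J. F i). P.prob (?E c))"
    proof (rule P.finite_measure_finite_Union[OF fin])
      show "?E ` (\<Pi>\<^sub>E i\<in>J. F i) \<subseteq> P.events" using meas by auto
      show "disjoint_family_on ?E (\<Pi>\<^sub>E i\<in>J. F i)"
        unfolding disjoint_family_on_def
        by (auto simp: PiE_iff intro!: extensionalityI)
    qed
    ultimately have "P.prob (prod_emb I ?C J (\<Pi>\<^sub>E i\<in>J. F i)) = (\<Sum>c\<in>(\<Pi>\<^sub>E i\<in>J. F i). (1/2) ^ card J)"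
      using cyl[OF J] by simp
    also have "\<dots> = (\<Prod>i\<in>J. real (card (F i)) / 2)"
      using J by (simp add: card_PiE prod_dividef power_one_over)
    also have "\<dots> = (\<Prod>i\<in>J. measure (?C i) (F i))"
    proof (intro prod.cong refl)
      fix i
      have "measure (measure_pmf (bernoulli_pmf (1/2))) (F i)
          = (\<Sum>x\<in>F i. pmf (bernoulli_pmf (1/2)) x)"
        by (rule measure_measure_pmf_finite) simp
      also have "\<dots> = (\<Sum>x\<in>F i. 1/2)"
        by (intro sum.cong refl) (case_tac x, simp_all)
      finally show "real (card (F i)) / 2 = measure (?C i) (F i)" by simp
    qed
    finally show "emeasure P (prod_emb I ?C J (\<Pi>\<^sub>E i\<in>J. F i)) = (\<Prod>i\<in>J. emeasure (?C i) (F i))"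
      by (simp add: P.emeasure_eq_measure measure_pmf.emeasure_eq_measure prod_ennreal)
  qed
qed

section \<open>Binary expansion of a uniform variable\<close>

definition digit :: "real \<Rightarrow> nat \<Rightarrow> bool" where
  "digit u i \<longleftrightarrow> odd \<lfloor>2 ^ Suc i * u\<rfloor>"

lemma floor_double: "\<lfloor>2 ^ Suc n * u\<rfloor> = 2 * \<lfloor>2 ^ n * u\<rfloor> + of_bool (digit u n)"
proof -
  let ?v = "2 ^ n * u"
  have e: "2 ^ Suc n * u = 2 * ?v" by simp
  have "\<lfloor>2 * ?v\<rfloor> = 2 * \<lfloor>?v\<rfloor> \<or> \<lfloor>2 * ?v\<rfloor> = 2 * \<lfloor>?v\<rfloor> + 1"
    by linarith
  then show ?thesis unfolding digit_def e by auto
qed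

lemma space_unit_uniform: "space unit_uniform = {0..1}"
  by (simp add: unit_uniform_def)

lemma sets_unit_uniform: "sets unit_uniform = sets unit_borel"
  by (simp add: unit_uniform_def unit_borel_def sets_restrict_space)

lemma prob_space_unit_uniform: "prob_space unit_uniform"
  by (rule prob_spaceI) (simp add: unit_uniform_def emeasure_restrict_space)

text \<open>The point 1 has to be set aside: all its digits are \<open>False\<close>, and
  \<open>bin_value\<close> would send them to 0.\<close>

lemma AE_unit_uniform_less_1: "AE u in unit_uniform. 0 \<le> u \<and> u < 1"
proof -
  have "AE u in lborel. u \<noteq> (1::real)" by (rule AE_lborel_singleton)
  then have "AE u in lborel. u \<in> {0..1} \<longrightarrow> 0 \<le> u \<and> u < (1::real)"
    by eventually_elim auto
  then show ?thesis unfolding unit_uniform_def by (subst AE_restrict_space_iff) simp_all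
qed

lemma measurable_unit_uniform_ident: "(\<lambda>u. u) \<in> borel_measurable unit_uniform"
  unfolding unit_uniform_def by (intro measurable_restrict_space1) simp

lemma measurable_digit [measurable]: "Measurable.pred unit_uniform (\<lambda>u. digit u i)"
  unfolding digit_def using measurable_unit_uniform_ident by measurable

text \<open>Read as a binary numeral, most significant digit first, the first \<open>n\<close>
  digits of \<open>u\<close> are the integer \<open>\<lfloor>2 ^ n * u\<rfloor>\<close>; the witness
  \<open>a\<close> is the numeral written by \<open>c\<close>.\<close>

lemma digits_prefix:
  fixes c :: "nat \<Rightarrow> bool"
  shows "\<exists>a::int. 0 \<le> a \<and> a < 2 ^ n \<and>
    (\<forall>u. 0 \<le> u \<and> u < 1 \<longrightarrow> (\<forall>i<n. digit u i = c i) = (\<lfloor>2 ^ n * u\<rfloor> = a))"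
proof (induction n)
  case 0
  show ?case by (intro exI[of _ 0]) (auto simp: floor_eq_iff)
next
  case (Suc n)
  then obtain a :: int where a: "0 \<le> a" "a < 2 ^ n"
    and IH: "\<And>u. 0 \<le> u \<Longrightarrow> u < 1 \<Longrightarrow> (\<forall>i<n. digit u i = c i) = (\<lfloor>2 ^ n * u\<rfloor> = a)"
    by blast
  show ?case
  proof (intro exI conjI allI impI)
    show "0 \<le> 2 * a + of_bool (c n)" "2 * a + of_bool (c n) < 2 ^ Suc n"
      using a by auto
    fix u :: real assume u: "0 \<le> u \<and> u < 1"
    have "(\<forall>i<Suc n. digit u i = c i) \<longleftrightarrow> \<lfloor>2 ^ n * u\<rfloor> = a \<and> digit u n = c n"
      using IH u by (auto simp: less_Suc_eq)
    also have "\<dots> \<longleftrightarrow> 2 * \<lfloor>2 ^ n * u\<rfloor> + of_bool (digit u n) = 2 * a + of_bool (c n)"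
      by (cases "digit u n"; cases "c n"; simp; presburger)
    finally show "(\<forall>i<Suc n. digit u i = c i) = (\<lfloor>2 ^ Suc n * u\<rfloor> = 2 * a + of_bool (c n))"
      unfolding floor_double .
  qed
qed

lemma measure_digits_prefix:
  "measure unit_uniform {u \<in> space unit_uniform. \<forall>i\<in>{..<n}. digit u i = c i} = (1/2) ^ n"
proof -
  interpret prob_space unit_uniform by (rule prob_space_unit_uniform)
  obtain a :: int where a: "0 \<le> a" "a < 2 ^ n"
    and eq: "\<And>u. 0 \<le> u \<Longrightarrow> u < 1 \<Longrightarrow> (\<forall>i<n. digit u i = c i) = (\<lfloor>2 ^ n * u\<rfloor> = a)"
    using digits_prefix[of n c] by blast
  \<comment> \<open>The dyadic interval on which the floor equals \<open>a\<close>. It may differ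
    from the digit event at the point 1, hence the comparison almost everywhere.\<close>
  let ?A = "{of_int a / 2 ^ n ..< (of_int a + 1) / 2 ^ n} :: real set"
  have ub: "(real_of_int a + 1) / 2 ^ n \<le> 1"
  proof -
    have "real_of_int (a + 1) \<le> real_of_int (2 ^ n)"
      using a by (subst of_int_le_iff) simp
    then show ?thesis by simp
  qed
  have lb: "0 \<le> real_of_int a / 2 ^ n"
    using a by simp
  have sub: "?A \<subseteq> {0..1}"
  proof
    fix x assume "x \<in> ?A"
    then have "real_of_int a / 2 ^ n \<le> x" "x < (real_of_int a + 1) / 2 ^ n" by auto
    then have "0 \<le> x" "x \<le> 1" using lb ub by linarith+
    then show "x \<in> {0..1}" by simp
  qed
  have "measure unit_uniform {u \<in> space unit_uniform. \<forall>i\<in>{..<n}. digit u i = c i} = measure unit_uniform ?A"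
  proof (rule finite_measure_eq_AE)
    show "AE x in unit_uniform. (x \<in> {u \<in> space unit_uniform. \<forall>i\<in>{..<n}. digit u i = c i}) = (x \<in> ?A)"
      using AE_unit_uniform_less_1
    proof eventually_elim
      case (elim u)
      have "(\<forall>i<n. digit u i = c i) \<longleftrightarrow> of_int a \<le> 2 ^ n * u \<and> 2 ^ n * u < of_int a + 1"
        using eq[of u] elim by (simp add: floor_eq_iff)
      then show ?case
        using elim by (auto simp: space_unit_uniform field_simps)
    qed
    show "{u \<in> space unit_uniform. \<forall>i\<in>{..<n}. digit u i = c i} \<in> events" by measurable
    show "?A \<in> events"
      using sub by (auto simp: unit_uniform_def sets_restrict_space_iff)
  qed
  also have "\<dots> = measure lborel ?A"
    using sub by (simp add: unit_uniform_def measure_restrict_space)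
  also have "\<dots> = (1/2) ^ n"
    by (simp add: divide_right_mono power_one_over flip: diff_divide_distrib)
  finally show ?thesis .
qed

text \<open>Downward induction on \<open>I\<close>: dropping one prescribed digit doubles the measure.\<close>

lemma measure_digits:
  assumes "finite I"
  shows "measure unit_uniform {u \<in> space unit_uniform. \<forall>i\<in>I. digit u i = c i} = (1/2) ^ card I"
proof -
  interpret prob_space unit_uniform by (rule prob_space_unit_uniform)
  obtain n where n: "I \<subseteq> {..<n}"
    using assms finite_nat_iff_bounded by blast
  have "card ({..<n} - J) = m \<Longrightarrow> J \<subseteq> {..<n} \<Longrightarrow>
    measure unit_uniform {u \<in> space unit_uniform. \<forall>i\<in>J. digit u i = c i} = (1/2) ^ card J" for J m c
  proof (induction m arbitrary: J c)
    case 0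
    then have "J = {..<n}" by auto
    then show ?case using measure_digits_prefix by simp
  next
    case (Suc m)
    then obtain k where k: "k < n" "k \<notin> J"
      by (metis Diff_iff card.empty lessThan_iff nat.distinct(1) ex_in_conv)
    have fin: "finite J" using Suc.prems finite_subset by blast
    have card: "card ({..<n} - insert k J) = m"
    proof -
      have "{..<n} - insert k J = ({..<n} - J) - {k}" by auto
      then show ?thesis using Suc.prems k by simp
    qed
    let ?E = "\<lambda>x. {u \<in> space unit_uniform. \<forall>i\<in>insert k J. digit u i = (c(k := x)) i}"
    have p: "prob (?E x) = (1/2) ^ Suc (card J)" for x
      using Suc.IH[OF card, of "c(k := x)"] Suc.prems k fin by simp
    have split: "{u \<in> space unit_uniform. \<forall>i\<in>J. digit u i = c i} = ?E True \<union> ?E False"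
      using k by auto
    have "prob (?E True \<union> ?E False) = prob (?E True) + prob (?E False)"
      using fin by (intro finite_measure_Union) auto
    then show ?case unfolding split p by simp
  qed
  then show ?thesis using n by blast
qed

definition bin_value :: "(nat \<Rightarrow> bool) \<Rightarrow> real" where
  "bin_value h = (\<Sum>i. of_bool (h i) * (1/2) ^ Suc i)"

lemma summable_bin_value: "summable (\<lambda>i. of_bool (h i) * (1/2::real) ^ Suc i)"
  by (rule summable_comparison_test'[where g = "\<lambda>i. (1/2) ^ Suc i" and N = 0])
    (auto intro: sums_summable[OF power_half_series])

lemma bin_value_bounds: "bin_value h \<in> {0..1}"
proof -
  have "bin_value h \<le> (\<Sum>i. (1/2::real) ^ Suc i)"
    unfolding bin_value_def
    by (rule suminf_le[OF _ summable_bin_value sums_summable[OF power_half_series]]) auto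
  also have "\<dots> = 1" using power_half_series sums_unique by fastforce
  finally show ?thesis
    unfolding bin_value_def using suminf_nonneg[OF summable_bin_value] by auto
qed

lemma bin_value_digit:
  assumes "0 \<le> u" "u < 1"
  shows "bin_value (digit u) = u"
proof -
  have part: "(\<Sum>i<n. of_bool (digit u i) * (1/2::real) ^ Suc i) = of_int \<lfloor>2 ^ n * u\<rfloor> / 2 ^ n" for n
  proof (induction n)
    case 0
    have "\<lfloor>u\<rfloor> = 0" using assms by (simp add: floor_eq_iff)
    then show ?case by simp
  next
    case (Suc n)
    show ?case
      unfolding sum.lessThan_Suc Suc floor_double by (simp add: field_simps power_one_over)
  qed
  have "(\<lambda>n. of_int \<lfloor>2 ^ n * u\<rfloor> / 2 ^ n) \<longlonglongrightarrow> u"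
  proof (rule tendsto_sandwich)
    show "\<forall>\<^sub>F n in sequentially. u - (1/2) ^ n \<le> of_int \<lfloor>2 ^ n * u\<rfloor> / 2 ^ n"
    proof (intro always_eventually allI)
      fix n
      have "2 ^ n * u - 1 \<le> of_int \<lfloor>2 ^ n * u\<rfloor>" by linarith
      then have "(2 ^ n * u - 1) / 2 ^ n \<le> of_int \<lfloor>2 ^ n * u\<rfloor> / 2 ^ n"
        by (rule divide_right_mono) simp
      then show "u - (1/2) ^ n \<le> of_int \<lfloor>2 ^ n * u\<rfloor> / 2 ^ n"
        by (simp add: diff_divide_distrib power_one_over)
    qed
    show "\<forall>\<^sub>F n in sequentially. of_int \<lfloor>2 ^ n * u\<rfloor> / 2 ^ n \<le> u"
      by (intro always_eventually allI) (simp add: field_simps)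
    have "(\<lambda>n. u - (1/2) ^ n) \<longlonglongrightarrow> u - 0"
      by (intro tendsto_intros LIMSEQ_power_zero) simp
    then show "(\<lambda>n. u - (1/2) ^ n) \<longlonglongrightarrow> u" by simp
  qed simp
  then have "(\<lambda>i. of_bool (digit u i) * (1/2::real) ^ Suc i) sums u"
    unfolding sums_def part .
  then show ?thesis unfolding bin_value_def by (rule sums_unique[symmetric])
qed

lemma measurable_bin_value: "bin_value \<in> coins UNIV \<rightarrow>\<^sub>M unit_borel"
  unfolding unit_borel_def
proof (rule measurable_restrict_space2)
  show "bin_value \<in> space (coins UNIV) \<rightarrow> {0..1}" using bin_value_bounds by auto
  show "bin_value \<in> borel_measurable (coins UNIV)"
    unfolding bin_value_def by measurable
qed

lemma distr_digit: "distr unit_uniform (coins UNIV) digit = coins UNIV"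
proof (rule coins_eqI)
  have m: "digit \<in> unit_uniform \<rightarrow>\<^sub>M coins UNIV"
    by (rule measurable_coinsI) auto
  show "prob_space (distr unit_uniform (coins UNIV) digit)"
    by (rule prob_space.prob_space_distr[OF prob_space_unit_uniform m])
  fix J :: "nat set" and c
  assume J: "finite J"
  have "{b \<in> space (coins UNIV). \<forall>i\<in>J. b i = c i} \<in> sets (coins UNIV)"
    using J by measurable
  then show "measure (distr unit_uniform (coins UNIV) digit)
      {b \<in> space (distr unit_uniform (coins UNIV) digit). \<forall>i\<in>J. b i = c i} = (1/2) ^ card J"
    using measure_digits[OF J, of c]
    by (simp add: measure_distr[OF m] space_coins vimage_def Int_def conj_commute)
qed simp

text \<open>Run backwards from a uniform \<open>u\<close>: its digits are fair coins by
  \<open>distr_digit\<close>, and \<open>bin_value\<close> returns \<open>u\<close> from them off a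
  null set.\<close>

lemma distr_bin_value: "distr (coins UNIV) unit_borel bin_value = unit_uniform"
proof -
  have m: "digit \<in> unit_uniform \<rightarrow>\<^sub>M coins UNIV"
    by (rule measurable_coinsI) auto
  have "distr (coins UNIV) unit_borel bin_value
      = distr (distr unit_uniform (coins UNIV) digit) unit_borel bin_value"
    by (simp add: distr_digit)
  also have "\<dots> = distr unit_uniform unit_borel (bin_value \<circ> digit)"
    by (rule distr_distr[OF measurable_bin_value m])
  also have "\<dots> = distr unit_uniform unit_borel (\<lambda>u. u)"
  proof (rule distr_cong_AE[OF refl refl])
    show "AE u in unit_uniform. (bin_value \<circ> digit) u = u"
      using AE_unit_uniform_less_1 by eventually_elim (simp add: bin_value_digit)
    show "bin_value \<circ> digit \<in> unit_uniform \<rightarrow>\<^sub>M unit_borel"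
      by (rule measurable_comp[OF m measurable_bin_value])
    show "(\<lambda>u. u) \<in> unit_uniform \<rightarrow>\<^sub>M unit_borel"
      by (rule measurable_ident_sets[OF sets_unit_uniform])
  qed
  also have "\<dots> = unit_uniform"
    using sets_unit_uniform by (intro distr_id2) simp
  finally show ?thesis .
qed

section \<open>Walks without backtracking in regular trees\<close>

text \<open>Only an immediate return \<open>x, y, x\<close> is forbidden. Extending such a list is a
  condition on its last two vertices, which makes counting easy; distinctness of all vertices is
  derived for trees in \<open>nb_walk_distinct\<close>.\<close>

fun nb_walk :: "'v rel \<Rightarrow> 'v list \<Rightarrow> bool" where
  "nb_walk E [] = True"
| "nb_walk E [x] = True"
| "nb_walk E [x, y] = ((x, y) \<in> E)"
| "nb_walk E (x # y # z # xs) = ((x, y) \<in> E \<and> x \<noteq> z \<and> nb_walk E (y # z # xs))"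

lemma nb_walk_append:
  assumes "nb_walk E (xs @ [a])" "nb_walk E (a # ys)"
    and "xs \<noteq> [] \<Longrightarrow> ys \<noteq> [] \<Longrightarrow> last xs \<noteq> hd ys"
  shows "nb_walk E (xs @ a # ys)"
  using assms
proof (induction xs rule: induct_list012)
  case (2 x)
  then show ?case by (cases ys) auto
next
  case (3 x y xs)
  then show ?case by (cases xs) auto
qed simp

lemma nb_walk_butlast: "nb_walk E (xs @ [a]) \<Longrightarrow> nb_walk E xs"
proof (induction xs rule: induct_list012)
  case (3 x y xs)
  then show ?case by (cases xs) auto
qed simp_all

lemma nb_walk_rev:
  assumes "sym E" "nb_walk E xs"
  shows "nb_walk E (rev xs)"
  using assms(2)
proof (induction xs rule: induct_list012)
  case (3 x y zs)
  have "nb_walk E (rev zs @ y # [x])"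
  proof (rule nb_walk_append)
    show "nb_walk E (rev zs @ [y])" using 3 by (cases zs) auto
    show "nb_walk E (y # [x])" using 3 symD[OF assms(1), of x y] by (cases zs) auto
    show "last (rev zs) \<noteq> hd [x]" if "rev zs \<noteq> []" using 3 that by (cases zs) auto
  qed
  then show ?case by simp
qed simp_all

lemma nb_walk_edge: "nb_walk E xs \<Longrightarrow> Suc i < length xs \<Longrightarrow> (xs ! i, xs ! Suc i) \<in> E"
proof (induction xs arbitrary: i rule: nb_walk.induct)
  case (4 E x y z xs)
  then show ?case by (cases i) auto
qed auto

lemma nb_walk_no_backtrack:
  "nb_walk E xs \<Longrightarrow> Suc (Suc i) < length xs \<Longrightarrow> xs ! i \<noteq> xs ! Suc (Suc i)"
proof (induction xs arbitrary: i rule: nb_walk.induct)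
  case (4 E x y z xs)
  then show ?case by (cases i) auto
qed auto

text \<open>Reachability is confined to the vertex set of the walk, so that later only this set, not
  the order along the walk, has to be remembered.\<close>

lemma nb_walk_reachable:
  "nb_walk E xs \<Longrightarrow> u \<in> set xs \<Longrightarrow> (hd xs, u) \<in> (E \<inter> set xs \<times> set xs)\<^sup>*"
proof (induction xs arbitrary: u rule: induct_list012)
  case (3 x y xs)
  have "(E \<inter> set (y # xs) \<times> set (y # xs))\<^sup>* \<subseteq> (E \<inter> set (x # y # xs) \<times> set (x # y # xs))\<^sup>*"
    by (rule rtrancl_mono) auto
  moreover have "nb_walk E (y # xs)" "(x, y) \<in> E \<inter> set (x # y # xs) \<times> set (x # y # xs)"
    using "3.prems" by (cases xs; auto)+
  moreover have "(y, u) \<in> (E \<inter> set (y # xs) \<times> set (y # xs))\<^sup>*" if "u \<noteq> x"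
    using "3.IH"(2)[of u] "3.prems"(2) that calculation(2) by simp
  ultimately have "(x, u) \<in> (E \<inter> set (x # y # xs) \<times> set (x # y # xs))\<^sup>*"
    by (cases "u = x") (blast intro: converse_rtrancl_into_rtrancl)+
  then show ?case by (simp only: list.sel)
qed simp_all

lemma upt_0_Suc_Cons: "[0..<Suc d] = 0 # map Suc [0..<d]"
  by (simp only: map_Suc_upt upt_conv_Cons zero_less_Suc)

text \<open>Library walks are arc lists. This and \<open>pawalk_verts_map_upt\<close> translate a
  vertex sequence into one, so that a cycle can be exhibited.\<close>

lemma pcas_map_upt: "pcas (f 0) (map (\<lambda>j. (f j, f (Suc j))) [0..<d]) (f d)"
proof (induction d arbitrary: f)
  case (Suc d)
  have "map (\<lambda>j. (f j, f (Suc j))) [0..<Suc d]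
      = (f 0, f 1) # map (\<lambda>j. (f (Suc j), f (Suc (Suc j)))) [0..<d]"
    by (simp add: upt_0_Suc_Cons o_def del: upt_Suc)
  then show ?case using Suc.IH[of "\<lambda>j. f (Suc j)"] by simp
qed simp

lemma pawalk_verts_map_upt:
  "pawalk_verts (f 0) (map (\<lambda>j. (f j, f (Suc j))) [0..<d]) = map f [0..<Suc d]"
proof (induction d arbitrary: f)
  case (Suc d)
  have "map (\<lambda>j. (f j, f (Suc j))) [0..<Suc d]
      = (f 0, f 1) # map (\<lambda>j. (f (Suc j), f (Suc (Suc j)))) [0..<d]"
    by (simp add: upt_0_Suc_Cons o_def del: upt_Suc)
  moreover have "map f [0..<Suc (Suc d)] = f 0 # map (\<lambda>j. f (Suc j)) [0..<Suc d]"
    by (simp add: upt_0_Suc_Cons o_def del: upt_Suc)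
  ultimately show ?case using Suc.IH[of "\<lambda>j. f (Suc j)"] by simp
qed simp

text \<open>Two equal entries at the least possible distance \<open>k\<close> bound a closed segment
  without further repetitions. Absence of loops excludes \<open>k = 1\<close>, absence of
  backtracking excludes \<open>k = 2\<close>, so the segment is a cycle that a tree forbids.\<close>

lemma nb_walk_distinct:
  assumes tree: "regular_tree d T" and walk: "nb_walk (parcs T) xs"
  shows "distinct xs"
proof (rule ccontr)
  interpret pair_bidirected_digraph T using tree by (simp add: regular_tree_def)
  let ?P = "\<lambda>k. 0 < k \<and> (\<exists>i. i + k < length xs \<and> xs ! i = xs ! (i + k))"
  assume "\<not> distinct xs"
  then obtain i j where ij: "i < length xs" "j < length xs" "i \<noteq> j" "xs ! i = xs ! j"
    unfolding distinct_conv_nth by blast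
  then obtain i j where "i < j" "j < length xs" "xs ! i = xs ! j"
    by (cases "i < j") (auto simp: not_less le_less)
  then have "?P (j - i)" by (intro conjI exI[of _ i]) auto
  then have P: "?P (LEAST k. ?P k)" by (rule LeastI)
  define k where "k = (LEAST k. ?P k)"
  obtain i where k: "0 < k" "i + k < length xs" "xs ! i = xs ! (i + k)"
    using P unfolding k_def by blast
  have min: "\<not> ?P k'" if "k' < k" for k'
    using that not_less_Least unfolding k_def by blast
  define f where "f j = xs ! (i + j)" for j
  have edge: "(f j, f (Suc j)) \<in> parcs T" if "j < k" for j
    using nb_walk_edge[OF walk, of "i + j"] that k unfolding f_def by auto
  have "k \<noteq> 1" using edge[of 0] pair_no_loops[of "(f 0, f 1)"] k by (auto simp: f_def)
  moreover have "k \<noteq> 2" using nb_walk_no_backtrack[OF walk, of i] k by auto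
  ultimately have "3 \<le> k" using k by linarith
  define p where "p = map (\<lambda>j. (f j, f (Suc j))) [0..<k]"
  have closed: "f k = f 0" using k by (simp add: f_def)
  have "cycle p"
    unfolding cycle_def
  proof (intro exI conjI)
    have "f 0 \<in> pverts T" using edge[of 0] k in_arcsD1 by blast
    moreover have "set p \<subseteq> parcs T" using edge by (auto simp: p_def)
    moreover have "pcas (f 0) p (f 0)" using pcas_map_upt[of f k] closed by (simp add: p_def)
    ultimately show "awalk (f 0) p (f 0)" by (simp add: awalk_def)
    show "p \<noteq> []" using k by (simp add: p_def)
    have "tl (pawalk_verts (f 0) p) = map f [1..<Suc k]"
      unfolding p_def pawalk_verts_map_upt by (simp only: map_tl[symmetric] tl_upt One_nat_def)
    moreover have "inj_on f {1..<Suc k}"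
    proof (rule linorder_inj_onI')
      fix a b assume ab: "a \<in> {1..<Suc k}" "b \<in> {1..<Suc k}" "a < b"
      then have "\<not> ?P (b - a)" by (intro min) auto
      moreover have "i + a + (b - a) = i + b" "i + b < length xs" using ab k by auto
      ultimately show "f a \<noteq> f b"
        using ab unfolding f_def by (metis zero_less_diff)
    qed
    ultimately show "distinct (tl (pawalk_verts (f 0) p))" by (simp add: distinct_map del: upt_Suc)
  qed
  moreover have "3 \<le> length p" using \<open>3 \<le> k\<close> by (simp add: p_def)
  ultimately show False using tree unfolding regular_tree_def by blast
qed

text \<open>
  After cancelling a common last step, one walk followed by the reverse of the other would be
  a closed walk without backtracking.
\<close>

lemma nb_walk_unique:
  assumes tree: "regular_tree d T"
  shows "nb_walk (parcs T) xs \<Longrightarrow> nb_walk (parcs T) ys \<Longrightarrow> length xs = length ys \<Longrightarrow>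
    hd xs = hd ys \<Longrightarrow> last xs = last ys \<Longrightarrow> xs = ys"
proof (induction xs arbitrary: ys rule: rev_induct)
  case (snoc a xs)
  interpret pair_bidirected_digraph T using tree by (simp add: regular_tree_def)
  have sym: "sym (parcs T)" using pair_sym_arcs by (simp add: symmetric_def)
  from snoc.prems obtain zs where ys: "ys = zs @ [a]" and len: "length xs = length zs"
    by (cases ys rule: rev_cases) auto
  show ?case
  proof (cases "xs = []")
    case False
    then have ne: "xs \<noteq> []" "zs \<noteq> []" using len by auto
    have hd: "hd xs = hd zs" using snoc.prems ne by (simp add: ys)
    have "last xs = last zs"
    proof (rule ccontr)
      assume neq: "last xs \<noteq> last zs"
      have "nb_walk (parcs T) (xs @ a # rev zs)"
      proof (rule nb_walk_append)
        show "nb_walk (parcs T) (xs @ [a])" by fact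
        show "nb_walk (parcs T) (a # rev zs)"
          using nb_walk_rev[OF sym] snoc.prems(2) ys by fastforce
        show "last xs \<noteq> hd (rev zs)" using neq ne by (simp add: hd_rev)
      qed
      then have "distinct (xs @ a # rev zs)" by (rule nb_walk_distinct[OF tree])
      moreover have "hd xs \<in> set xs" "hd xs \<in> set zs"
        using ne hd list.set_sel(1) by metis+
      ultimately show False by auto
    qed
    then have "xs = zs"
      using snoc.prems len hd ys by (intro snoc.IH) (auto dest: nb_walk_butlast)
    then show ?thesis using ys by simp
  qed (use ys len in simp)
qed simp

text \<open>At most one of the three neighbours of the last vertex leads back, so each walk keeps
  two extensions. Keeping only two at the root as well gives the round number
  \<open>2 ^ n\<close>.\<close>

lemma nb_walks_many:
  assumes tree: "regular_tree 3 T" and v: "v \<in> pverts T"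
  shows "\<exists>S. finite S \<and> card S = 2 ^ n \<and>
    (\<forall>xs\<in>S. nb_walk (parcs T) xs \<and> length xs = Suc n \<and> hd xs = v \<and> last xs \<in> pverts T)"
proof (induction n)
  case 0
  show ?case using v by (intro exI[of _ "{[v]}"]) simp
next
  case (Suc n)
  interpret pair_bidirected_digraph T using tree by (simp add: regular_tree_def)
  from Suc obtain S where S: "finite S" "card S = 2 ^ n"
    and walks: "\<And>xs. xs \<in> S \<Longrightarrow> nb_walk (parcs T) xs \<and> length xs = Suc n \<and> hd xs = v \<and> last xs \<in> pverts T"
    by blast
  have ext: "\<exists>b c. b \<noteq> c \<and> (last xs, b) \<in> parcs T \<and> (last xs, c) \<in> parcs T \<and>
      nb_walk (parcs T) (xs @ [b]) \<and> nb_walk (parcs T) (xs @ [c])" if "xs \<in> S" for xs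
  proof -
    have ne: "xs \<noteq> []" using walks[OF that] by auto
    let ?N = "{b. (last xs, b) \<in> parcs T}"
    have "out_arcs (with_proj T) (last xs) = Pair (last xs) ` ?N"
      by (auto simp: out_arcs_def)
    then have "card (Pair (last xs) ` ?N) = 3"
      using tree walks[OF that] unfolding regular_tree_def out_degree_def by metis
    then have "card ?N = 3" by (subst (asm) card_image) (auto simp: inj_on_def)
    \<comment> \<open>For a one-vertex walk \<open>last (butlast xs)\<close> is an unspecified
      vertex; removing it still costs at most one of the three neighbours.\<close>
    then have "2 \<le> card (?N - {last (butlast xs)})"
      by (simp add: card_Diff_singleton_if)
    then obtain D where D: "D \<subseteq> ?N - {last (butlast xs)}" "card D = 2"
      by (rule obtain_subset_with_card_n)
    obtain b c where "D = {b, c}" "b \<noteq> c" using D(2) unfolding card_2_iff by blast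
    then have bc: "b \<noteq> c" "b \<in> ?N" "c \<in> ?N" "b \<noteq> last (butlast xs)" "c \<noteq> last (butlast xs)"
      using D(1) by auto
    have xs: "butlast xs @ [last xs] = xs" using ne by simp
    have "nb_walk (parcs T) (xs @ [e])" if "e \<in> ?N" "e \<noteq> last (butlast xs)" for e
    proof -
      have "nb_walk (parcs T) (butlast xs @ last xs # [e])"
      proof (rule nb_walk_append)
        show "nb_walk (parcs T) (butlast xs @ [last xs])" unfolding xs using walks[OF \<open>xs \<in> S\<close>] by blast
        show "nb_walk (parcs T) (last xs # [e])" using that by simp
        show "last (butlast xs) \<noteq> hd [e]" using that by simp
      qed
      moreover have "butlast xs @ last xs # [e] = (butlast xs @ [last xs]) @ [e]" by simp
      ultimately show ?thesis unfolding xs by simp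
    qed
    then show ?thesis using bc by blast
  qed
  define Q where "Q xs b c \<longleftrightarrow> b \<noteq> c \<and> (last xs, b) \<in> parcs T \<and> (last xs, c) \<in> parcs T \<and>
      nb_walk (parcs T) (xs @ [b]) \<and> nb_walk (parcs T) (xs @ [c])" for xs b c
  have "\<forall>xs\<in>S. \<exists>b c. Q xs b c" using ext unfolding Q_def by blast
  then obtain b c where "\<forall>xs\<in>S. Q xs (b xs) (c xs)" by metis
  then have bc: "\<And>xs. xs \<in> S \<Longrightarrow> b xs \<noteq> c xs \<and> (last xs, b xs) \<in> parcs T \<and> (last xs, c xs) \<in> parcs T \<and>
      nb_walk (parcs T) (xs @ [b xs]) \<and> nb_walk (parcs T) (xs @ [c xs])"
    unfolding Q_def by blast
  let ?B = "(\<lambda>xs. xs @ [b xs]) ` S" and ?C = "(\<lambda>xs. xs @ [c xs]) ` S"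
  have "card (?B \<union> ?C) = card ?B + card ?C"
    using S bc by (intro card_Un_disjoint) (simp, simp, fastforce)
  also have "\<dots> = 2 ^ Suc n"
    using S by (subst (1 2) card_image) (auto simp: inj_on_def)
  finally have "card (?B \<union> ?C) = 2 ^ Suc n" .
  moreover have "\<forall>ys\<in>?B \<union> ?C. nb_walk (parcs T) ys \<and> length ys = Suc (Suc n) \<and> hd ys = v \<and> last ys \<in> pverts T"
  proof
    fix ys assume "ys \<in> ?B \<union> ?C"
    then obtain xs where xs: "xs \<in> S" and ys: "ys = xs @ [b xs] \<or> ys = xs @ [c xs]" by blast
    have "xs \<noteq> []" using walks[OF xs] by auto
    show "nb_walk (parcs T) ys \<and> length ys = Suc (Suc n) \<and> hd ys = v \<and> last ys \<in> pverts T"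
    proof -
      obtain e where "ys = xs @ [e]" "(last xs, e) \<in> parcs T" "nb_walk (parcs T) (xs @ [e])"
        using ys bc[OF xs] by blast
      then show ?thesis
        using walks[OF xs] \<open>xs \<noteq> []\<close> in_arcsD2[of "last xs" e] by simp
    qed
  qed
  ultimately show ?case using S by (intro exI[of _ "?B \<union> ?C"]) simp
qed

text \<open>By \<open>nb_walk_unique\<close> an endpoint determines its walk, so the walks may be
  indexed by their endpoints, and \<open>P\<close> is obtained from the inverse of
  \<open>last\<close>.\<close>

lemma regular_tree_paths:
  assumes tree: "regular_tree 3 T" and v: "v \<in> pverts T"
  shows "\<exists>S P. finite S \<and> card S = 2 ^ n \<and> S \<subseteq> pverts T \<and>
    (\<forall>g\<in>S. P g \<subseteq> pverts T \<and> finite (P g) \<and> card (P g) = Suc n \<and> v \<in> P g \<and> g \<in> P g \<and>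
      (\<forall>u\<in>P g. (v, u) \<in> (parcs T \<inter> P g \<times> P g)\<^sup>*))"
proof -
  interpret pair_bidirected_digraph T using tree by (simp add: regular_tree_def)
  obtain W where W: "finite W" "card W = 2 ^ n"
    and walks: "\<And>xs. xs \<in> W \<Longrightarrow> nb_walk (parcs T) xs \<and> length xs = Suc n \<and> hd xs = v \<and> last xs \<in> pverts T"
    using nb_walks_many[OF tree v] by blast
  have inj: "inj_on last W"
  proof (rule inj_onI)
    fix xs ys assume "xs \<in> W" "ys \<in> W" "last xs = last ys"
    then show "xs = ys" using walks by (intro nb_walk_unique[OF tree]) auto
  qed
  define P where "P g = set (the_inv_into W last g)" for g
  have P: "P (last xs) = set xs" if "xs \<in> W" for xs
    using the_inv_into_f_f[OF inj that] by (simp add: P_def)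
  show ?thesis
  proof (intro exI conjI ballI)
    show "finite (last ` W)" using W by simp
    show "card (last ` W) = 2 ^ n" using W inj by (simp add: card_image)
    show "last ` W \<subseteq> pverts T" using walks by auto
    fix g assume "g \<in> last ` W"
    then obtain xs where xs: "xs \<in> W" and g: "g = last xs" by blast
    note w = walks[OF xs]
    then have ne: "xs \<noteq> []" by auto
    have Pg: "P g = set xs" using P[OF xs] g by simp
    show "finite (P g)" by (simp add: P_def)
    show "card (P g) = Suc n"
      using nb_walk_distinct[OF tree] w Pg by (simp add: distinct_card)
    show "v \<in> P g" unfolding Pg using w ne list.set_sel(1) by metis
    show "g \<in> P g" unfolding Pg using ne g by simp
    have reach: "(v, u) \<in> (parcs T \<inter> P g \<times> P g)\<^sup>*" if "u \<in> P g" for u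
    proof -
      have "nb_walk (parcs T) xs" "u \<in> set xs" "hd xs = v" using w that Pg by blast+
      then show ?thesis unfolding Pg using nb_walk_reachable by metis
    qed
    then show "(v, u) \<in> (parcs T \<inter> P g \<times> P g)\<^sup>*" if "u \<in> P g" for u
      using that by blast
    show "P g \<subseteq> pverts T"
    proof
      fix u assume "u \<in> P g"
      then have "(v, u) \<in> (parcs T \<inter> P g \<times> P g)\<^sup>*" by (rule reach)
      then show "u \<in> pverts T" using v in_arcsD2 by (cases rule: rtrancl.cases) blast+
    qed
  qed
qed

section \<open>Chains of paths and their labels\<close>

text \<open>
  The coins \<open>Mem k i\<close> of a vertex with \<open>i < depth k\<close> decide whether it lies in level \<open>k\<close> (all must
  be heads, so level \<open>k\<close> has density \<open>2\<close> to the power \<open>- depth k\<close>); the coins \<open>Lab k j\<close> are the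
  digits of its level \<open>k\<close> label.
\<close>

datatype coin_index = Mem nat nat | Lab nat nat

instance coin_index :: countable
  by countable_datatype

definition scale :: "nat \<Rightarrow> nat" where "scale k = 2 ^ (2 * k + 8)"

text \<open>Among \<open>2 ^ scale k\<close> candidates, \<open>2 ^ slack k\<close> lie in level
  \<open>Suc k\<close> on average. Agreement in \<open>k\<close> digits costs \<open>k\<close> of
  the exponent; the remaining \<open>2 * k + 8\<close> is the binary logarithm of
  \<open>scale k\<close>, which is thus the expected number of partners.\<close>

definition slack :: "nat \<Rightarrow> nat" where "slack k = 3 * k + 8"

text \<open>The subtraction is never truncated, by \<open>slack_le\<close>. Level 0 contains every
  vertex.\<close>

primrec depth :: "nat \<Rightarrow> nat" where
  "depth 0 = 0"
| "depth (Suc k) = scale k - slack k"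

text \<open>
  \<open>S k\<close> plays the role of the sphere of radius \<open>scale k\<close>; of the tree only these sets and the
  vertex sets \<open>P k g\<close> of the paths from \<open>1\<close> to \<open>g\<close> matter.
\<close>

locale path_system = group \<Gamma> for \<Gamma> :: "('g, 'm) monoid_scheme" (structure) +
  fixes S :: "nat \<Rightarrow> 'g set" and P :: "nat \<Rightarrow> 'g \<Rightarrow> 'g set"
  assumes countable_carrier: "countable (carrier \<Gamma>)"
    and S_carrier: "S k \<subseteq> carrier \<Gamma>"
    and finite_S: "finite (S k)"
    and card_S: "card (S k) = 2 ^ scale k"
    and P_carrier: "g \<in> S k \<Longrightarrow> P k g \<subseteq> carrier \<Gamma>"
    and finite_P: "g \<in> S k \<Longrightarrow> finite (P k g)"
    and card_P: "g \<in> S k \<Longrightarrow> card (P k g) = Suc (scale k)"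
    and one_in_P: "g \<in> S k \<Longrightarrow> \<one> \<in> P k g"
    and end_in_P: "g \<in> S k \<Longrightarrow> g \<in> P k g"
begin

abbreviation sites :: "('g \<times> coin_index) set" where
  "sites \<equiv> carrier \<Gamma> \<times> UNIV"

definition in_level :: "('g \<times> coin_index \<Rightarrow> bool) \<Rightarrow> nat \<Rightarrow> 'g \<Rightarrow> bool" where
  "in_level b k x \<longleftrightarrow> (\<forall>i<depth k. b (x, Mem k i))"

definition targets :: "('g \<times> coin_index \<Rightarrow> bool) \<Rightarrow> nat \<Rightarrow> 'g \<Rightarrow> 'g set" where
  "targets b k x = {g \<in> S k. in_level b (Suc k) (x \<otimes> g) \<and>
     (\<forall>j<k. b (x \<otimes> g, Lab (Suc k) j) = b (x, Lab k j))}"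

text \<open>
  The choice depends only on the set of relative positions \<open>g\<close>, so it commutes with left
  translations without any tie-breaking randomness. On the empty set it still returns an element
  of \<open>S k\<close>, which keeps all chains inside the group.
\<close>

definition pick :: "nat \<Rightarrow> 'g set \<Rightarrow> 'g" where
  "pick k T = (SOME g. g \<in> (if T = {} then S k else T))"

abbreviation step :: "('g \<times> coin_index \<Rightarrow> bool) \<Rightarrow> nat \<Rightarrow> 'g \<Rightarrow> 'g" where
  "step b k x \<equiv> pick k (targets b k x)"

primrec chain :: "('g \<times> coin_index \<Rightarrow> bool) \<Rightarrow> nat \<Rightarrow> 'g \<Rightarrow> nat \<Rightarrow> 'g" where
  "chain b k x 0 = x"
| "chain b k x (Suc i) = chain b k x i \<otimes> step b (k + i) (chain b k x i)"

definition route :: "nat \<Rightarrow> 'g \<Rightarrow> 'g \<Rightarrow> 'g set" where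
  "route k x g = (\<lambda>p. x \<otimes> p) ` P k g"

text \<open>
  The exceptions are the paths that belong to the chain of \<open>x\<close> itself or merge with it at the
  endpoint \<open>x \<otimes> g\<close>. All \<open>h\<close> are admitted, not only the chosen one, so that a clash is a
  statement about the levels of at most four vertices.
\<close>

definition clash :: "('g \<times> coin_index \<Rightarrow> bool) \<Rightarrow> nat \<Rightarrow> 'g \<Rightarrow> 'g \<Rightarrow> bool" where
  "clash b k x g \<longleftrightarrow> (\<exists>m. k \<le> m \<and> (\<exists>z\<in>carrier \<Gamma>. \<exists>h\<in>S m.
     in_level b m z \<and> in_level b (Suc m) (z \<otimes> h) \<and> route m z h \<inter> route k x g \<noteq> {} \<and>
     (m, z) \<noteq> (k, x) \<and> (m, z) \<noteq> (Suc k, x \<otimes> g) \<and> (m, z \<otimes> h) \<noteq> (k, x \<otimes> g)))"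

definition clear :: "('g \<times> coin_index \<Rightarrow> bool) \<Rightarrow> nat \<Rightarrow> 'g \<Rightarrow> bool" where
  "clear b k x \<longleftrightarrow> in_level b k x \<and> targets b k x \<noteq> {} \<and> \<not> clash b k x (step b k x)"

definition good :: "('g \<times> coin_index \<Rightarrow> bool) \<Rightarrow> nat \<Rightarrow> 'g \<Rightarrow> bool" where
  "good b k x \<longleftrightarrow> (\<forall>i. clear b (k + i) (chain b k x i))"

abbreviation seg :: "('g \<times> coin_index \<Rightarrow> bool) \<Rightarrow> nat \<Rightarrow> 'g \<Rightarrow> 'g set" where
  "seg b k x \<equiv> route k x (step b k x)"

text \<open>
  The vertex after \<open>Suc j\<close> steps has level \<open>k + Suc j > j\<close>, and from there on the chain no longer
  changes the digit \<open>j\<close>.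
\<close>

definition hue :: "('g \<times> coin_index \<Rightarrow> bool) \<Rightarrow> nat \<Rightarrow> 'g \<Rightarrow> nat \<Rightarrow> bool" where
  "hue b k x j = b (chain b k x (Suc j), Lab (k + Suc j) j)"

definition covers :: "('g \<times> coin_index \<Rightarrow> bool) \<Rightarrow> 'g \<Rightarrow> nat \<Rightarrow> 'g \<Rightarrow> bool" where
  "covers b v k x \<longleftrightarrow> good b k x \<and> v \<in> seg b k x"

text \<open>The existential hides no choice: all pairs that cover \<open>v\<close> have the same
  hue, by \<open>hue_unique\<close>. Uncovered vertices fall back on the digits
  \<open>Lab 0\<close>, which no chain reads and which a flip changes like all others.\<close>

definition lab :: "('g \<times> coin_index \<Rightarrow> bool) \<Rightarrow> 'g \<Rightarrow> nat \<Rightarrow> bool" where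
  "lab b v j \<longleftrightarrow> (\<exists>k. \<exists>x\<in>carrier \<Gamma>. covers b v k x \<and> hue b k x j) \<or>
     \<not> (\<exists>k. \<exists>x\<in>carrier \<Gamma>. covers b v k x) \<and> b (v, Lab 0 j)"

section \<open>Chains through a common vertex carry the same label\<close>

lemma targets_subset: "targets b k x \<subseteq> S k"
  by (auto simp: targets_def)

lemma pick_in: assumes "T \<subseteq> S k" shows "pick k T \<in> S k"
proof -
  have "S k \<noteq> {}" using card_S[of k] by auto
  then have "pick k T \<in> (if T = {} then S k else T)"
    unfolding pick_def some_in_eq by simp
  then show ?thesis using assms by (auto split: if_splits)
qed

lemma pick_in_nonempty: "T \<noteq> {} \<Longrightarrow> pick k T \<in> T"
  unfolding pick_def by (simp add: some_in_eq)

lemma step_in: "step b k x \<in> S k"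
  by (rule pick_in[OF targets_subset])

lemma step_carrier [simp]: "step b k x \<in> carrier \<Gamma>"
  using step_in S_carrier by blast

lemma chain_carrier [simp]: "x \<in> carrier \<Gamma> \<Longrightarrow> chain b k x i \<in> carrier \<Gamma>"
  by (induction i) auto

lemma chain_Suc_front: "chain b k x (Suc i) = chain b (Suc k) (x \<otimes> step b k x) i"
  by (induction i) auto

lemma good_clear: "good b k x \<Longrightarrow> clear b k x"
  unfolding good_def by (metis add.right_neutral chain.simps(1))

lemma good_step: assumes "good b k x" shows "good b (Suc k) (x \<otimes> step b k x)"
  unfolding good_def
proof
  fix i
  have "clear b (k + Suc i) (chain b k x (Suc i))" using assms unfolding good_def by blast
  then show "clear b (Suc k + i) (chain b (Suc k) (x \<otimes> step b k x) i)"
    by (simp only: chain_Suc_front add_Suc_shift)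
qed

lemma good_chain: "good b k x \<Longrightarrow> good b (k + i) (chain b k x i)"
  using good_step by (induction i) auto

lemma hue_step:
  assumes "good b k x"
  shows "hue b (Suc k) (x \<otimes> step b k x) = hue b k x"
proof
  fix j
  \<comment> \<open>The hue of the shifted chain reads digit \<open>j\<close> one vertex after
    \<open>?y\<close>. The step in between preserves it because
    \<open>j < k + Suc j\<close>.\<close>
  let ?y = "chain b k x (Suc j)"
  have "targets b (k + Suc j) ?y \<noteq> {}"
    using assms unfolding good_def clear_def by blast
  then have "step b (k + Suc j) ?y \<in> targets b (k + Suc j) ?y" by (rule pick_in_nonempty)
  then have "b (?y \<otimes> step b (k + Suc j) ?y, Lab (Suc (k + Suc j)) j) = b (?y, Lab (k + Suc j) j)"
    unfolding targets_def by simp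
  moreover have "?y \<otimes> step b (k + Suc j) ?y = chain b (Suc k) (x \<otimes> step b k x) (Suc j)"
    by (simp only: chain_Suc_front[symmetric] chain.simps(2)[of b k x "Suc j"])
  ultimately show "hue b (Suc k) (x \<otimes> step b k x) j = hue b k x j"
    unfolding hue_def by simp
qed

text \<open>Absence of a clash at the lower level leaves three cases: the same segment, the next
  segment of the same chain, or two segments of equal level with a common endpoint. In each of them
  the hues agree by \<open>hue_step\<close>.\<close>

lemma hue_unique_le:
  assumes x: "x \<in> carrier \<Gamma>" "covers b v k x" and z: "z \<in> carrier \<Gamma>" "covers b v m z"
    and "k \<le> m"
  shows "hue b k x = hue b m z"
proof -
  have good: "good b k x" "good b m z" and v: "v \<in> seg b k x" "v \<in> seg b m z"
    using x z by (auto simp: covers_def)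
  have cl: "clear b k x" "clear b m z" using good good_clear by auto
  have "step b m z \<in> targets b m z"
    using cl by (intro pick_in_nonempty) (simp add: clear_def)
  then have lev: "in_level b m z" "in_level b (Suc m) (z \<otimes> step b m z)"
    using cl by (auto simp: clear_def targets_def)
  have "\<not> clash b k x (step b k x)" using cl by (simp add: clear_def)
  then have "(m, z) = (k, x) \<or> (m, z) = (Suc k, x \<otimes> step b k x) \<or>
      (m, z \<otimes> step b m z) = (k, x \<otimes> step b k x)"
    unfolding clash_def using \<open>k \<le> m\<close> z(1) step_in[of m b z] lev v by blast
  then show ?thesis
  proof (elim disjE)
    assume "(m, z \<otimes> step b m z) = (k, x \<otimes> step b k x)"
    then show ?thesis using hue_step[OF good(1)] hue_step[OF good(2)] by auto
  qed (use hue_step[OF good(1)] in auto)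
qed

lemma hue_unique:
  assumes "x \<in> carrier \<Gamma>" "covers b v k x" "z \<in> carrier \<Gamma>" "covers b v m z"
  shows "hue b k x = hue b m z"
  using hue_unique_le[OF assms] hue_unique_le[OF assms(3,4,1,2)] by (cases "k \<le> m") auto

lemma lab_eq_hue:
  assumes "x \<in> carrier \<Gamma>" "covers b v k x"
  shows "lab b v = hue b k x"
  using hue_unique[OF assms] assms unfolding lab_def fun_eq_iff by blast

text \<open>
  Translating by \<open>a\<close> and flipping the label digits at the positions in \<open>s\<close>. With \<open>s = False\<close> this is
  equivariance; with \<open>a = 1\<close> it is the symmetry that makes the marginals uniform.
\<close>

definition twisted :: "'g \<Rightarrow> (nat \<Rightarrow> bool) \<Rightarrow> ('g \<times> coin_index \<Rightarrow> bool) \<Rightarrow> ('g \<times> coin_index \<Rightarrow> bool) \<Rightarrow> bool" where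
  "twisted a s b c \<longleftrightarrow> (\<forall>x\<in>carrier \<Gamma>. \<forall>k i. c (x, Mem k i) = b (a \<otimes> x, Mem k i) \<and>
     c (x, Lab k i) = (b (a \<otimes> x, Lab k i) \<noteq> s i))"

context
  fixes a s b c
  assumes a: "a \<in> carrier \<Gamma>" and tw: "twisted a s b c"
begin

lemma twisted_level: "x \<in> carrier \<Gamma> \<Longrightarrow> in_level c k x = in_level b k (a \<otimes> x)"
  using tw by (auto simp: twisted_def in_level_def)

lemma twisted_targets:
  assumes "x \<in> carrier \<Gamma>"
  shows "targets c k x = targets b k (a \<otimes> x)"
proof -
  have "in_level c (Suc k) (x \<otimes> g) \<and> (\<forall>j<k. c (x \<otimes> g, Lab (Suc k) j) = c (x, Lab k j)) \<longleftrightarrow>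
    in_level b (Suc k) (a \<otimes> x \<otimes> g) \<and> (\<forall>j<k. b (a \<otimes> x \<otimes> g, Lab (Suc k) j) = b (a \<otimes> x, Lab k j))"
    if "g \<in> S k" for g
  proof -
    have g: "g \<in> carrier \<Gamma>" using that S_carrier by blast
    then have "a \<otimes> (x \<otimes> g) = a \<otimes> x \<otimes> g" using a assms by (simp add: m_assoc)
    then show ?thesis
      using twisted_level[of "x \<otimes> g"] tw assms g unfolding twisted_def by auto
  qed
  then show ?thesis unfolding targets_def by auto
qed

lemma twisted_chain:
  assumes "x \<in> carrier \<Gamma>"
  shows "chain b k (a \<otimes> x) i = a \<otimes> chain c k x i"
proof (induction i)
  case (Suc i)
  then show ?case using assms a by (simp add: twisted_targets m_assoc)
qed simp

lemma twisted_route: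
  assumes "x \<in> carrier \<Gamma>" "g \<in> S k"
  shows "route k (a \<otimes> x) g = (\<lambda>v. a \<otimes> v) ` route k x g"
  using assms a P_carrier[of g k] unfolding route_def image_image
  by (intro image_cong) (auto simp: m_assoc)

lemma route_carrier: "x \<in> carrier \<Gamma> \<Longrightarrow> g \<in> S k \<Longrightarrow> route k x g \<subseteq> carrier \<Gamma>"
  using P_carrier[of g k] unfolding route_def by auto

lemma inj_mult: "inj_on (\<lambda>v. a \<otimes> v) (carrier \<Gamma>)"
  using a by (simp add: inj_on_def)

lemma twisted_clash:
  assumes "x \<in> carrier \<Gamma>" and g: "g \<in> S k"
  shows "clash c k x g = clash b k (a \<otimes> x) g"
proof -
  have gc: "g \<in> carrier \<Gamma>" using g S_carrier by blast
  let ?Q = "\<lambda>m z h. in_level b m z \<and> in_level b (Suc m) (z \<otimes> h) \<and> route m z h \<inter> route k (a \<otimes> x) g \<noteq> {} \<and>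
     (m, z) \<noteq> (k, a \<otimes> x) \<and> (m, z) \<noteq> (Suc k, a \<otimes> x \<otimes> g) \<and> (m, z \<otimes> h) \<noteq> (k, a \<otimes> x \<otimes> g)"
  have eq: "(in_level c m z \<and> in_level c (Suc m) (z \<otimes> h) \<and> route m z h \<inter> route k x g \<noteq> {} \<and>
     (m, z) \<noteq> (k, x) \<and> (m, z) \<noteq> (Suc k, x \<otimes> g) \<and> (m, z \<otimes> h) \<noteq> (k, x \<otimes> g)) \<longleftrightarrow> ?Q m (a \<otimes> z) h"
    if z: "z \<in> carrier \<Gamma>" and h: "h \<in> S m" for m z h
  proof -
    have hc: "h \<in> carrier \<Gamma>" using h S_carrier by blast
    have "route m (a \<otimes> z) h \<inter> route k (a \<otimes> x) g = (\<lambda>v. a \<otimes> v) ` (route m z h \<inter> route k x g)"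
      using assms z h by (simp add: twisted_route inj_on_image_Int[OF inj_mult] route_carrier)
    moreover have "a \<otimes> z \<otimes> h = a \<otimes> (z \<otimes> h)" "a \<otimes> x \<otimes> g = a \<otimes> (x \<otimes> g)"
      using a z hc assms gc by (simp_all add: m_assoc)
    ultimately show ?thesis
      using a z hc assms gc by (simp add: twisted_level)
  qed
  \<comment> \<open>Left translation by \<open>a\<close> permutes the carrier, so the quantifier
    over foreign starting points can be reindexed.\<close>
  have surj: "\<exists>z\<in>carrier \<Gamma>. z' = a \<otimes> z" if "z' \<in> carrier \<Gamma>" for z'
    using that a by (intro bexI[of _ "inv a \<otimes> z'"]) (simp_all add: m_assoc[symmetric])
  have "(\<exists>z\<in>carrier \<Gamma>. R (a \<otimes> z)) \<longleftrightarrow> (\<exists>z\<in>carrier \<Gamma>. R z)" for R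
    using surj a by (metis m_closed)
  from this[of "\<lambda>z. \<exists>h\<in>S m. ?Q m z h" for m]
  show ?thesis unfolding clash_def using eq by (auto cong: bex_cong)
qed

lemma twisted_clear: "x \<in> carrier \<Gamma> \<Longrightarrow> clear c k x = clear b k (a \<otimes> x)"
  unfolding clear_def by (simp add: twisted_level twisted_targets twisted_clash step_in)

lemma twisted_good: "x \<in> carrier \<Gamma> \<Longrightarrow> good c k x = good b k (a \<otimes> x)"
  unfolding good_def by (simp add: twisted_clear twisted_chain)

lemma twisted_hue: "x \<in> carrier \<Gamma> \<Longrightarrow> hue c k x j = (hue b k (a \<otimes> x) j \<noteq> s j)"
  using tw unfolding hue_def by (simp only: twisted_chain) (simp add: twisted_def del: chain.simps)

lemma twisted_covers:
  assumes "x \<in> carrier \<Gamma>" "v \<in> carrier \<Gamma>"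
  shows "covers c v k x = covers b (a \<otimes> v) k (a \<otimes> x)"
proof -
  have "v \<in> seg c k x \<longleftrightarrow> a \<otimes> v \<in> seg b k (a \<otimes> x)"
    using assms route_carrier[OF assms(1) step_in]
    by (simp add: twisted_route step_in inj_on_image_mem_iff[OF inj_mult] flip: twisted_targets)
  then show ?thesis using assms by (simp add: covers_def twisted_good)
qed

lemma twisted_lab:
  assumes v: "v \<in> carrier \<Gamma>"
  shows "lab c v j = (lab b (a \<otimes> v) j \<noteq> s j)"
proof (cases "\<exists>k. \<exists>x\<in>carrier \<Gamma>. covers c v k x")
  case True
  then obtain k x where x: "x \<in> carrier \<Gamma>" "covers c v k x" by blast
  then have "a \<otimes> x \<in> carrier \<Gamma>" "covers b (a \<otimes> v) k (a \<otimes> x)"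
    using a twisted_covers v by auto
  then show ?thesis using x by (simp add: lab_eq_hue twisted_hue)
next
  case False
  have "\<not> (\<exists>k. \<exists>x\<in>carrier \<Gamma>. covers b (a \<otimes> v) k x)"
  proof
    assume "\<exists>k. \<exists>x\<in>carrier \<Gamma>. covers b (a \<otimes> v) k x"
    then obtain k x where x: "x \<in> carrier \<Gamma>" "covers b (a \<otimes> v) k x" by blast
    have "a \<otimes> (inv a \<otimes> x) = x" using a x by (simp add: m_assoc[symmetric])
    then have "covers c v k (inv a \<otimes> x)" using twisted_covers[of "inv a \<otimes> x" v k] a x v by simp
    then show False using False a x by auto
  qed
  then show ?thesis using False tw v unfolding lab_def twisted_def by auto
qed

end

end

section \<open>Measurability and symmetry of the labels\<close>

lemma pred_countable_bex:
  assumes "countable I" "\<And>i. i \<in> I \<Longrightarrow> Measurable.pred M (\<lambda>x. Q x i)"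
  shows "Measurable.pred M (\<lambda>x. \<exists>i\<in>I. Q x i)"
  using assms unfolding pred_def by (intro sets.sets_Collect_countable_Ex') auto

text \<open>Independence of events on disjoint coins, by induction on \<open>G\<close>. The cylinder
  over \<open>K\<close> makes the induction close: excluding one more \<open>g\<close> subtracts the
  same event with \<open>K\<close> enlarged by \<open>J g\<close>.\<close>

lemma measure_coins_avoid:
  fixes J :: "'a \<Rightarrow> 'i set"
  assumes "finite G" "finite K" "K \<subseteq> I"
    and J: "\<And>g. g \<in> G \<Longrightarrow> finite (J g) \<and> J g \<subseteq> I \<and> card (J g) = d"
    and disj: "disjoint_family_on J G" "\<And>g. g \<in> G \<Longrightarrow> K \<inter> J g = {}"
  shows "measure (coins I) {b \<in> space (coins I). (\<forall>i\<in>K. b i = c i) \<and> (\<forall>g\<in>G. \<not> (\<forall>i\<in>J g. b i = c i))}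
    = (1/2) ^ card K * (1 - (1/2) ^ d) ^ card G"
  using assms
proof (induction G arbitrary: K rule: finite_induct)
  case empty
  then show ?case by (simp add: measure_coins_cylinder)
next
  case (insert g G)
  interpret prob_space "coins I" by (rule prob_space_coins)
  let ?E = "\<lambda>K. {b \<in> space (coins I). (\<forall>i\<in>K. b i = c i) \<and> (\<forall>g\<in>G. \<not> (\<forall>i\<in>J g. b i = c i))}"
  have g: "finite (J g)" "J g \<subseteq> I" "card (J g) = d" and G: "\<And>h. h \<in> G \<Longrightarrow> finite (J h) \<and> J h \<subseteq> I \<and> card (J h) = d"
    using insert.prems(3) by auto
  have disjG: "disjoint_family_on J G" and Jg: "\<And>h. h \<in> G \<Longrightarrow> J g \<inter> J h = {}"
    using insert.prems(4) insert.hyps(2) by (auto simp: disjoint_family_on_def)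
  have Kg: "K \<inter> J g = {}" and KG: "\<And>h. h \<in> G \<Longrightarrow> K \<inter> J h = {}"
    using insert.prems(5) by auto
  have meas: "?E L \<in> events" if "finite L" "L \<subseteq> I" for L
  proof -
    have "Measurable.pred (coins I) (\<lambda>b. (\<forall>i\<in>L. b i = c i) \<and> (\<forall>g\<in>G. \<not> (\<forall>i\<in>J g. b i = c i)))"
      using that G insert.hyps(1) by (intro pred_intros_logic pred_intros_finite(3) pred_cylinder) auto
    then show ?thesis by (simp add: pred_def)
  qed
  have card: "card (K \<union> J g) = card K + d"
    using insert.prems(1) g Kg by (simp add: card_Un_disjoint)
  have eq: "{b \<in> space (coins I). (\<forall>i\<in>K. b i = c i) \<and> (\<forall>h\<in>insert g G. \<not> (\<forall>i\<in>J h. b i = c i))}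
      = ?E K - ?E (K \<union> J g)"
    by auto
  have "prob (?E K - ?E (K \<union> J g)) = prob (?E K) - prob (?E (K \<union> J g))"
    using insert.prems(1,2) g by (intro finite_measure_Diff meas) auto
  moreover have "prob (?E K) = (1/2) ^ card K * (1 - (1/2) ^ d) ^ card G"
    using insert.prems(1,2) G disjG KG by (intro insert.IH) auto
  moreover have "prob (?E (K \<union> J g)) = (1/2) ^ card (K \<union> J g) * (1 - (1/2) ^ d) ^ card G"
  proof (rule insert.IH)
    show "(K \<union> J g) \<inter> J h = {}" if "h \<in> G" for h
      using KG[OF that] Jg[OF that] by blast
  qed (use insert.prems(1,2) G disjG g in auto)
  ultimately show ?case
    unfolding eq using insert.hyps by (simp add: card power_add algebra_simps)
qed

lemma (in prob_space) prob_finite_Union_le: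
  assumes "finite T" "card T \<le> N" "\<And>t. t \<in> T \<Longrightarrow> E t \<in> events \<and> prob (E t) \<le> r" "0 \<le> r"
  shows "prob (\<Union>t\<in>T. E t) \<le> real N * r"
proof -
  have "prob (\<Union>t\<in>T. E t) \<le> (\<Sum>t\<in>T. prob (E t))"
    using assms by (intro finite_measure_subadditive_finite) auto
  also have "\<dots> \<le> (\<Sum>t\<in>T. r)" using assms by (intro sum_mono) auto
  also have "\<dots> \<le> real N * r" using assms by (simp add: mult_right_mono)
  finally show ?thesis .
qed

lemma (in prob_space) prob_Union_geometric_le:
  assumes E: "\<And>i::nat. E i \<in> events" "\<And>i. prob (E i) \<le> r * (1/2) ^ i"
  shows "prob (\<Union>i. E i) \<le> 2 * r"
proof -
  have geo: "summable (\<lambda>i. r * (1/2::real) ^ i)"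
    by (intro summable_mult summable_geometric) simp
  have sm: "summable (\<lambda>i. prob (E i))"
    by (rule summable_comparison_test'[OF geo, of 0]) (simp add: E)
  have "prob (\<Union>i. E i) \<le> (\<Sum>i. prob (E i))"
    using E(1) sm by (intro finite_measure_subadditive_countably) auto
  also have "\<dots> \<le> (\<Sum>i. r * (1/2) ^ i)" by (rule suminf_le[OF E(2) sm geo])
  also have "\<dots> = 2 * r" by (subst suminf_mult) (simp_all add: suminf_geometric)
  finally show ?thesis .
qed

section \<open>Connectedness and infinity of good chains\<close>

context path_system
begin

text \<open>All vertices of a segment are covered by the same pair and hence equally labelled, and
  the segment is connected within itself. Consecutive segments share a vertex, which passes the
  label on.\<close>

lemma chain_connected:
  assumes E: "\<And>u v x. (u, v) \<in> E \<Longrightarrow> x \<in> carrier \<Gamma> \<Longrightarrow> (x \<otimes> u, x \<otimes> v) \<in> E"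
    and conn: "\<And>k g u. g \<in> S k \<Longrightarrow> u \<in> P k g \<Longrightarrow> (\<one>, u) \<in> (E \<inter> P k g \<times> P k g)\<^sup>*"
    and x: "x \<in> carrier \<Gamma>" and good: "good b k x"
    and v: "v \<in> seg b (k + i) (chain b k x i)"
  shows "(x, v) \<in> {(u, w) \<in> E. lab b u = lab b w}\<^sup>*"
proof -
  let ?F = "{(u, w) \<in> E. lab b u = lab b w}"
  have seg: "(y, v) \<in> ?F\<^sup>*" if y: "y \<in> carrier \<Gamma>" "good b m y" and v: "v \<in> seg b m y" for y m v
  proof -
    let ?g = "step b m y"
    obtain u where u: "u \<in> P m ?g" "v = y \<otimes> u" using v unfolding route_def by blast
    have "(\<one>, u) \<in> (E \<inter> P m ?g \<times> P m ?g)\<^sup>*" using conn step_in u by blast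
    then have "(y \<otimes> \<one>, y \<otimes> u) \<in> ?F\<^sup>*"
    proof (induction rule: rtrancl_induct)
      case (step p q)
      have "covers b (y \<otimes> p) m y" "covers b (y \<otimes> q) m y"
        using step y(2) unfolding covers_def route_def by auto
      then have "(y \<otimes> p, y \<otimes> q) \<in> ?F"
        using lab_eq_hue[OF y(1)] step E y(1) by auto
      then show ?case using step by (meson rtrancl.rtrancl_into_rtrancl)
    qed simp
    then show ?thesis using u y by simp
  qed
  have "(x, chain b k x i) \<in> ?F\<^sup>*"
  proof (induction i)
    case (Suc i)
    let ?y = "chain b k x i"
    have "chain b k x (Suc i) \<in> seg b (k + i) ?y"
      unfolding route_def using end_in_P[OF step_in] by auto
    then have "(?y, chain b k x (Suc i)) \<in> ?F\<^sup>*"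
      by (rule seg[OF _ good_chain[OF good], rotated]) (simp add: x)
    then show ?case using Suc by (meson rtrancl_trans)
  qed simp
  moreover have "(chain b k x i, v) \<in> ?F\<^sup>*"
    by (rule seg[OF _ good_chain[OF good] v]) (simp add: x)
  ultimately show ?thesis by (meson rtrancl_trans)
qed

lemma card_seg:
  assumes "x \<in> carrier \<Gamma>"
  shows "card (seg b k x) = Suc (scale k)"
proof -
  have "inj_on (\<lambda>p. x \<otimes> p) (P k (step b k x))"
    using subsetD[OF P_carrier[OF step_in]] assms by (intro inj_onI) simp
  then show ?thesis unfolding route_def by (simp add: card_image card_P[OF step_in])
qed

lemma scale_ge: "k \<le> scale k"
proof -
  have "k < 2 ^ k" by (rule less_exp)
  also have "(2::nat) ^ k \<le> 2 ^ (2 * k + 8)" by (rule power_increasing) auto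
  finally show ?thesis by (simp add: scale_def)
qed

text \<open>Segments may overlap, so their union is not counted; it is infinite because the size of
  a single segment is unbounded along the chain.\<close>

lemma infinite_chain_segs:
  assumes "x \<in> carrier \<Gamma>"
  shows "infinite (\<Union>i. seg b (k + i) (chain b k x i))"
proof
  assume fin: "finite (\<Union>i. seg b (k + i) (chain b k x i))" (is "finite ?U")
  have "card ?U < Suc (scale (k + card ?U))" using scale_ge[of "k + card ?U"] by simp
  also have "\<dots> = card (seg b (k + card ?U) (chain b k x (card ?U)))"
    using assms by (simp add: card_seg)
  also have "\<dots> \<le> card ?U" using fin by (intro card_mono) auto
  finally show False by simp
qed

abbreviation law :: "('g \<times> coin_index \<Rightarrow> bool) measure" where
  "law \<equiv> coins sites"

section \<open>Measurability of the construction\<close>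

lemma pred_in_level [measurable (raw)]:
  "x \<in> carrier \<Gamma> \<Longrightarrow> Measurable.pred law (\<lambda>b. in_level b k x)"
  unfolding in_level_def by measurable

lemma mult_S_carrier: "x \<in> carrier \<Gamma> \<Longrightarrow> g \<in> S k \<Longrightarrow> x \<otimes> g \<in> carrier \<Gamma>"
  using S_carrier by auto

lemma pred_targets_eq:
  assumes x: "x \<in> carrier \<Gamma>"
  shows "Measurable.pred law (\<lambda>b. targets b k x = T)"
proof (cases "T \<subseteq> S k")
  case True
  have "targets b k x = T \<longleftrightarrow> (\<forall>g\<in>S k. (in_level b (Suc k) (x \<otimes> g) \<and>
     (\<forall>j<k. b (x \<otimes> g, Lab (Suc k) j) = b (x, Lab k j))) \<longleftrightarrow> g \<in> T)" for b
    using True unfolding targets_def by blast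
  moreover have "Measurable.pred law (\<lambda>b. \<forall>g\<in>S k. (in_level b (Suc k) (x \<otimes> g) \<and>
     (\<forall>j<k. b (x \<otimes> g, Lab (Suc k) j) = b (x, Lab k j))) \<longleftrightarrow> g \<in> T)"
  proof (rule pred_intros_finite(3)[OF finite_S])
    fix g assume g: "g \<in> S k"
    have [measurable]: "Measurable.pred law (\<lambda>b. in_level b (Suc k) (x \<otimes> g))"
      "Measurable.pred law (\<lambda>b. b (x \<otimes> g, Lab (Suc k) j))" "Measurable.pred law (\<lambda>b. b (x, Lab k j))" for j
      using mult_S_carrier[OF x g] x by (auto intro!: pred_in_level measurable_coins_component)
    show "Measurable.pred law (\<lambda>b. (in_level b (Suc k) (x \<otimes> g) \<and>
       (\<forall>j<k. b (x \<otimes> g, Lab (Suc k) j) = b (x, Lab k j))) \<longleftrightarrow> g \<in> T)"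
      by measurable
  qed
  ultimately show ?thesis by simp
next
  case False
  then have "(\<lambda>b. targets b k x = T) = (\<lambda>_. False)" using targets_subset by blast
  then show ?thesis by simp
qed

text \<open>\<open>targets b k x\<close> has only finitely many possible values, so every function
  of it is measurable, including \<open>pick\<close> with its arbitrary choice.\<close>

lemma pred_targets:
  assumes x: "x \<in> carrier \<Gamma>"
  shows "Measurable.pred law (\<lambda>b. Q (targets b k x))"
proof -
  have "Q (targets b k x) \<longleftrightarrow> (\<exists>T\<in>{T \<in> Pow (S k). Q T}. targets b k x = T)" for b
    using targets_subset by blast
  moreover have "Measurable.pred law (\<lambda>b. \<exists>T\<in>{T \<in> Pow (S k). Q T}. targets b k x = T)"
    using finite_S by (intro pred_intros_finite(4) pred_targets_eq x) auto
  ultimately show ?thesis by simp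
qed

lemma pred_step:
  assumes x: "x \<in> carrier \<Gamma>" and Q: "\<And>g. g \<in> S k \<Longrightarrow> Measurable.pred law (\<lambda>b. Q b g)"
  shows "Measurable.pred law (\<lambda>b. Q b (step b k x))"
proof -
  have "Q b (step b k x) \<longleftrightarrow> (\<exists>g\<in>S k. step b k x = g \<and> Q b g)" for b
    using step_in by auto
  moreover have "Measurable.pred law (\<lambda>b. \<exists>g\<in>S k. step b k x = g \<and> Q b g)"
  proof (rule pred_intros_finite(4)[OF finite_S])
    fix g assume "g \<in> S k"
    then show "Measurable.pred law (\<lambda>b. step b k x = g \<and> Q b g)"
      using pred_targets[OF x, of "\<lambda>T. pick k T = g" k] Q by (simp add: pred_intros_logic)
  qed
  ultimately show ?thesis by simp
qed

text \<open>The next step depends on the coins as well as on the current vertex. Therefore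
  \<open>Q\<close> takes both, and the induction absorbs the step into \<open>Q\<close>.\<close>

lemma pred_chain:
  assumes x: "x \<in> carrier \<Gamma>" and Q: "\<And>y. y \<in> carrier \<Gamma> \<Longrightarrow> Measurable.pred law (\<lambda>b. Q b y)"
  shows "Measurable.pred law (\<lambda>b. Q b (chain b k x i))"
  using Q
proof (induction i arbitrary: Q)
  case 0
  then show ?case using x by simp
next
  case (Suc i)
  have "Measurable.pred law (\<lambda>b. (\<lambda>b y. Q b (y \<otimes> step b (k + i) y)) b (chain b k x i))"
    by (rule Suc.IH, rule pred_step) (auto intro!: Suc.prems mult_S_carrier)
  then show ?case by simp
qed

lemma pred_clash:
  assumes x: "x \<in> carrier \<Gamma>"
  shows "Measurable.pred law (\<lambda>b. clash b k x g)"
  unfolding clash_def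
proof (intro pred_intros_countable(2) pred_intros_logic pred_countable_bex countable_carrier
    countable_finite[OF finite_S])
  fix m z h assume "z \<in> carrier \<Gamma>" "h \<in> S m"
  then show "Measurable.pred law (\<lambda>b. in_level b m z)" "Measurable.pred law (\<lambda>b. in_level b (Suc m) (z \<otimes> h))"
    by (auto intro!: pred_in_level mult_S_carrier)
qed auto

lemma pred_clear: "x \<in> carrier \<Gamma> \<Longrightarrow> Measurable.pred law (\<lambda>b. clear b k x)"
  using pred_in_level[of x k] pred_targets[of x "\<lambda>T. T \<noteq> {}" k]
    pred_step[of x k "\<lambda>b g. \<not> clash b k x g"] pred_clash[of x k]
  unfolding clear_def by (simp add: pred_intros_logic)

lemma pred_good: "x \<in> carrier \<Gamma> \<Longrightarrow> Measurable.pred law (\<lambda>b. good b k x)"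
  using pred_chain[where Q = "\<lambda>b y. clear b (k + i) y" for i] pred_clear
  unfolding good_def by (intro pred_intros_countable(1)) blast

lemma pred_hue: "x \<in> carrier \<Gamma> \<Longrightarrow> Measurable.pred law (\<lambda>b. hue b k x j)"
  unfolding hue_def
  by (rule pred_chain[where Q = "\<lambda>b y. b (y, Lab (k + Suc j) j)"])
    (auto intro: measurable_coins_component)

lemma pred_covers: "x \<in> carrier \<Gamma> \<Longrightarrow> Measurable.pred law (\<lambda>b. covers b v k x)"
  using pred_good[of x k] pred_targets[of x "\<lambda>T. v \<in> route k x (pick k T)" k]
  unfolding covers_def by (simp add: pred_intros_logic)

lemma pred_lab:
  assumes "v \<in> carrier \<Gamma>"
  shows "Measurable.pred law (\<lambda>b. lab b v j)"
proof -
  have "Measurable.pred law (\<lambda>b. \<exists>k. \<exists>x\<in>carrier \<Gamma>. covers b v k x \<and> hue b k x j)"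
    by (intro pred_intros_countable(2) pred_countable_bex countable_carrier pred_intros_logic
        pred_covers pred_hue)
  moreover have "Measurable.pred law (\<lambda>b. \<exists>k. \<exists>x\<in>carrier \<Gamma>. covers b v k x)"
    by (intro pred_intros_countable(2) pred_countable_bex countable_carrier pred_covers)
  moreover have "Measurable.pred law (\<lambda>b. b (v, Lab 0 j))"
    using assms by (intro measurable_coins_component) simp
  ultimately show ?thesis unfolding lab_def by (intro pred_intros_logic)
qed

lemma measurable_lab: "v \<in> carrier \<Gamma> \<Longrightarrow> (\<lambda>b. lab b v) \<in> law \<rightarrow>\<^sub>M coins UNIV"
  by (rule measurable_coinsI) (auto intro: pred_lab)

section \<open>Digit flips and the law of one label\<close>

definition flip :: "(nat \<Rightarrow> bool) \<Rightarrow> ('g \<times> coin_index \<Rightarrow> bool) \<Rightarrow> ('g \<times> coin_index \<Rightarrow> bool)" where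
  "flip s b = (\<lambda>(x, i)\<in>sites. b (x, i) \<noteq> (case i of Mem _ _ \<Rightarrow> False | Lab _ j \<Rightarrow> s j))"

lemma twisted_flip: "twisted \<one> s b (flip s b)"
  by (simp add: twisted_def flip_def)

lemma lab_flip: "v \<in> carrier \<Gamma> \<Longrightarrow> lab (flip s b) v j = (lab b v j \<noteq> s j)"
  using twisted_lab[OF one_closed twisted_flip] by simp

lemma measurable_flip: "flip s \<in> law \<rightarrow>\<^sub>M law"
proof (rule measurable_coinsI)
  fix i assume i: "i \<in> sites"
  then have [measurable]: "Measurable.pred law (\<lambda>b. b i)" by (rule measurable_coins_component)
  have "flip s b i = (b i \<noteq> (case snd i of Mem _ _ \<Rightarrow> False | Lab _ j \<Rightarrow> s j))" for b
    using i by (auto simp: flip_def)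
  then show "Measurable.pred law (\<lambda>b. flip s b i)" by simp
qed (simp add: flip_def)

lemma distr_flip: "distr law law (flip s) = law"
proof (rule coins_eqI)
  show "prob_space (distr law law (flip s))"
    by (rule prob_space.prob_space_distr[OF prob_space_coins measurable_flip])
  fix J :: "('g \<times> coin_index) set" and c :: "'g \<times> coin_index \<Rightarrow> bool"
  assume J: "finite J" "J \<subseteq> sites"
  let ?c = "\<lambda>i. c i \<noteq> (case snd i of Mem _ _ \<Rightarrow> False | Lab _ j \<Rightarrow> s j)"
  have E: "{b \<in> space law. \<forall>i\<in>J. b i = c i} \<in> sets law"
    using pred_cylinder[OF J] by (simp add: pred_def)
  have "flip s b i = c i \<longleftrightarrow> b i = ?c i" if "i \<in> J" for i b
    using that J by (auto simp: flip_def split: coin_index.splits)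
  then have "flip s -` {b \<in> space law. \<forall>i\<in>J. b i = c i} \<inter> space law
      = {b \<in> space law. \<forall>i\<in>J. b i = ?c i}"
    using measurable_space[OF measurable_flip[of s]] by auto
  then show "measure (distr law law (flip s)) {b \<in> space (distr law law (flip s)). \<forall>i\<in>J. b i = c i} = (1/2) ^ card J"
    using measure_coins_cylinder[OF J, of ?c] by (simp add: measure_distr[OF measurable_flip E])
qed simp

lemma distr_lab:
  assumes v: "v \<in> carrier \<Gamma>"
  shows "distr law (coins UNIV) (\<lambda>b. lab b v) = coins UNIV"
proof (rule coins_eqI)
  interpret prob_space law by (rule prob_space_coins)
  note m = measurable_lab[OF v]
  show "prob_space (distr law (coins UNIV) (\<lambda>b. lab b v))"
    by (rule prob_space_distr[OF m])
  fix J :: "nat set" and c :: "nat \<Rightarrow> bool"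
  assume J: "finite J"
  have [measurable]: "Measurable.pred law (\<lambda>b. lab b v j)" for j by (rule pred_lab[OF v])
  let ?E = "\<lambda>c. {b \<in> space law. \<forall>j\<in>J. lab b v j = c j}"
  have meas: "?E c \<in> events" for c using J by measurable
  have flip: "prob (?E c) = prob (?E (\<lambda>_. False))" for c
  proof -
    have "prob (?E c) = measure (distr law law (flip c)) (?E c)" by (simp add: distr_flip)
    also have "\<dots> = prob (flip c -` ?E c \<inter> space law)" by (rule measure_distr[OF measurable_flip meas])
    also have "flip c -` ?E c \<inter> space law = ?E (\<lambda>_. False)"
      using measurable_space[OF measurable_flip[of c]] by (auto simp: lab_flip[OF v])
    finally show ?thesis .
  qed
  have fin: "finite (\<Pi>\<^sub>E j\<in>J. UNIV :: bool set)" using J by (intro finite_PiE) auto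
  \<comment> \<open>The \<open>2 ^ card J\<close> patterns partition the space, and flipping by a
    pattern shows it to be as likely as the constant one.\<close>
  have "1 = prob (\<Union>c\<in>(\<Pi>\<^sub>E j\<in>J. UNIV). ?E c)"
  proof -
    have "space law \<subseteq> (\<Union>c\<in>(\<Pi>\<^sub>E j\<in>J. UNIV). ?E c)"
    proof
      fix b assume "b \<in> space law"
      then show "b \<in> (\<Union>c\<in>(\<Pi>\<^sub>E j\<in>J. UNIV). ?E c)"
        by (intro UN_I[of "restrict (lab b v) J"]) auto
    qed
    then have "(\<Union>c\<in>(\<Pi>\<^sub>E j\<in>J. UNIV). ?E c) = space law" by auto
    then show ?thesis by (simp add: prob_space)
  qed
  also have "\<dots> = (\<Sum>c\<in>(\<Pi>\<^sub>E j\<in>J. UNIV). prob (?E c))"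
  proof (rule finite_measure_finite_Union[OF fin])
    show "?E ` (\<Pi>\<^sub>E j\<in>J. UNIV) \<subseteq> events" using meas by auto
    show "disjoint_family_on ?E (\<Pi>\<^sub>E j\<in>J. UNIV)"
      unfolding disjoint_family_on_def by (auto simp: PiE_iff intro!: extensionalityI)
  qed
  also have "\<dots> = (\<Sum>c\<in>(\<Pi>\<^sub>E j\<in>J. UNIV :: bool set). prob (?E (\<lambda>_. False)))"
    by (intro sum.cong refl flip)
  also have "\<dots> = 2 ^ card J * prob (?E (\<lambda>_. False))"
    using J by (simp add: card_PiE)
  finally have "prob (?E (\<lambda>_. False)) = (1/2) ^ card J"
    by (simp add: field_simps power_one_over)
  then have "prob (?E c) = (1/2) ^ card J" using flip by simp
  moreover have "{h \<in> space (coins UNIV). \<forall>j\<in>J. h j = c j} \<in> sets (coins UNIV)"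
    using J by measurable
  ultimately show "measure (distr law (coins UNIV) (\<lambda>b. lab b v))
      {h \<in> space (distr law (coins UNIV) (\<lambda>b. lab b v)). \<forall>j\<in>J. h j = c j} = (1/2) ^ card J"
    by (simp add: measure_distr[OF m] space_coins vimage_def Int_def conj_commute)
qed simp

end

section \<open>Almost sure existence of good chains\<close>

definition scale_sum :: "nat \<Rightarrow> nat" where "scale_sum k = (\<Sum>l<k. scale l)"

lemma scale_Suc: "scale (Suc k) = 4 * scale k"
  by (simp add: scale_def power_add)

lemma scale_sum_Suc: "scale_sum (Suc k) = scale_sum k + scale k"
  by (simp add: scale_sum_def)

text \<open>A geometric sum with ratio 4 and initial term 256. The factor 3 is the margin on which
  the union bounds live.\<close>

lemma scale_eq_scale_sum: "scale k = 3 * scale_sum k + 256"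
proof (induction k)
  case 0
  show ?case by (simp add: scale_def scale_sum_def)
qed (simp add: scale_Suc scale_sum_Suc)

lemma le_scale_sum: "k \<le> scale_sum k"
proof (induction k)
  case (Suc k)
  then show ?case using scale_eq_scale_sum[of k] by (simp add: scale_sum_Suc)
qed simp

lemma scale_sum_mono: "k \<le> m \<Longrightarrow> scale_sum k \<le> scale_sum m"
  unfolding scale_sum_def by (intro sum_mono2) auto

lemma slack_le: "slack k \<le> scale k"
  using scale_eq_scale_sum[of k] le_scale_sum[of k] by (simp add: slack_def)

lemma depth_Suc_slack: "depth (Suc k) + slack k = scale k"
  using slack_le by simp

text \<open>The linear terms of \<open>clash_exponent\<close>: with \<open>k = Suc k'\<close> and
  \<open>m = Suc m'\<close>, the four slacks, the path lengths and the gain add up to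
  \<open>9 * k' + 9 * m' + 62\<close>, at most \<open>18 * m' + 62\<close>. Against them stands
  \<open>scale m' - scale_sum k'\<close>, which is at least
  \<open>2 * scale_sum m' + 256\<close>.\<close>

lemma linear_le_scale_sum: "18 * k + 62 \<le> 2 * scale_sum k + 256"
proof (induction k)
  case (Suc k)
  then show ?case using scale_eq_scale_sum[of k] by (simp add: scale_sum_Suc)
qed simp

text \<open>
  The left side is the binary logarithm of the number of candidate clashes of levels \<open>k\<close> and \<open>m\<close>,
  plus a gain \<open>k + m\<close>; the right side comes from the four level conditions.
\<close>

lemma clash_exponent:
  assumes "1 \<le> k" "k \<le> m"
  shows "scale_sum k + scale k + scale m + (2 * k + 9) + (2 * m + 9) + k + m
    \<le> depth k + depth (Suc k) + depth m + depth (Suc m)"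
proof -
  obtain k' m' where k': "k = Suc k'" and m': "m = Suc m'" using assms by (cases k; cases m) auto
  have "scale_sum k' \<le> scale_sum m'" using assms k' m' by (intro scale_sum_mono) simp
  then show ?thesis
    using linear_le_scale_sum[of m'] depth_Suc_slack[of k'] depth_Suc_slack[of m'] depth_Suc_slack[of k] depth_Suc_slack[of m]
      scale_eq_scale_sum[of m'] scale_sum_Suc[of k'] assms
    unfolding k' m' slack_def by simp
qed

lemma two_power_half_power: "(2::real) ^ a * (1/2) ^ (a + n) = (1/2) ^ n"
  by (simp add: power_add power_one_over)

section \<open>Union bounds for the failures of a chain\<close>

context path_system
begin

lemma mult_image_card:
  assumes "finite W" shows "card ((\<lambda>(w, g). w \<otimes> g) ` (W \<times> S k)) \<le> card W * 2 ^ scale k"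
  using card_image_le[of "W \<times> S k" "\<lambda>(w, g). w \<otimes> g"] assms finite_S[of k]
  by (simp add: card_cartesian_product card_S)

text \<open>All positions that some outcome of the coins could give to the chain, a deterministic
  set over which union bounds can be taken.\<close>

primrec reach :: "nat \<Rightarrow> nat \<Rightarrow> 'g set" where
  "reach n 0 = {\<one>}"
| "reach n (Suc i) = (\<lambda>(w, g). w \<otimes> g) ` (reach n i \<times> S (n + i))"

lemma reach_carrier: "reach n i \<subseteq> carrier \<Gamma>"
  by (induction i) (auto intro!: mult_S_carrier)

lemma finite_reach: "finite (reach n i)"
  by (induction i) (auto simp: finite_S)

lemma card_reach: "card (reach n i) \<le> 2 ^ scale_sum (n + i)"
proof (induction i)
  case (Suc i)
  have "card (reach n (Suc i)) \<le> card (reach n i) * 2 ^ scale (n + i)"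
    using mult_image_card[OF finite_reach] by simp
  also have "\<dots> \<le> 2 ^ scale_sum (n + i) * 2 ^ scale (n + i)" using Suc by simp
  also have "\<dots> = 2 ^ scale_sum (n + Suc i)" by (simp add: scale_sum_Suc power_add)
  finally show ?case .
qed simp

lemma chain_reach: "chain b n \<one> i \<in> reach n i"
  by (induction i) (auto intro!: image_eqI step_in)

lemma prob_in_levels:
  assumes L: "finite L" "snd ` L \<subseteq> carrier \<Gamma>"
  shows "measure law {b \<in> space law. \<forall>(k, x)\<in>L. in_level b k x} = (1/2) ^ (\<Sum>(k, x)\<in>L. depth k)"
proof -
  let ?f = "\<lambda>((k, x), i). (x, Mem k i)"
  let ?J = "?f ` (SIGMA y:L. {..<depth (fst y)})"
  have "inj_on ?f (SIGMA y:L. {..<depth (fst y)})" by (auto simp: inj_on_def)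
  then have "card ?J = (\<Sum>(k, x)\<in>L. depth k)"
    using L by (simp add: card_image card_SigmaI case_prod_unfold)
  moreover have "finite ?J" "?J \<subseteq> sites" using L by auto
  moreover have "(\<forall>(k, x)\<in>L. in_level b k x) \<longleftrightarrow> (\<forall>i\<in>?J. b i = True)" for b
    by (force simp: in_level_def)
  ultimately show ?thesis using measure_coins_cylinder[of ?J sites "\<lambda>_. True"] by simp
qed

lemma prob_four_levels:
  assumes "x1 \<in> carrier \<Gamma>" "x2 \<in> carrier \<Gamma>" "x3 \<in> carrier \<Gamma>" "x4 \<in> carrier \<Gamma>"
    and "distinct [(k1, x1), (k2, x2), (k3, x3), (k4, x4)]"
  shows "measure law {b \<in> space law. in_level b k1 x1 \<and> in_level b k2 x2 \<and> in_level b k3 x3 \<and> in_level b k4 x4}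
    = (1/2) ^ (depth k1 + depth k2 + depth k3 + depth k4)"
proof -
  let ?L = "{(k1, x1), (k2, x2), (k3, x3), (k4, x4)}"
  have "(\<Sum>(k, x)\<in>?L. depth k) = depth k1 + depth k2 + depth k3 + depth k4"
    using assms(5) by auto
  then show ?thesis using prob_in_levels[of ?L] assms(1-4) by simp
qed

text \<open>Once the digits of \<open>w\<close> are fixed, the candidates are independent trials
  with success probability \<open>(1/2) ^ d\<close>. There are \<open>2 ^ scale k\<close> of them,
  and \<open>1 - x \<le> exp (- x)\<close> bounds the chance that all fail.\<close>

lemma prob_targets_empty:
  assumes w: "w \<in> carrier \<Gamma>"
  shows "measure law {b \<in> space law. targets b k w = {}} \<le> (1/2) ^ scale k"
proof -
  interpret prob_space law by (rule prob_space_coins)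
  define d where "d = depth (Suc k) + k"
  \<comment> \<open>\<open>K\<close> holds the coins for the first \<open>k\<close> digits of
    \<open>w\<close>, with values \<open>t\<close>; \<open>J g\<close> holds the coins that make
    \<open>w \<otimes> g\<close> a partner. The pattern \<open>c t\<close> asks for heads on
    membership coins and for \<open>t\<close> on label coins.\<close>
  define K where "K = Pair w ` Lab k ` {..<k}"
  define J where "J g = Pair (w \<otimes> g) ` (Mem (Suc k) ` {..<depth (Suc k)} \<union> Lab (Suc k) ` {..<k})" for g
  define c where "c t = (\<lambda>(x :: 'g, i). case i of Mem _ _ \<Rightarrow> True | Lab _ j \<Rightarrow> t j)" for t :: "nat \<Rightarrow> bool"
  define T where "T = (\<Pi>\<^sub>E j\<in>{..<k}. UNIV :: bool set)"
  let ?E = "\<lambda>t. {b \<in> space law. (\<forall>i\<in>K. b i = c t i) \<and> (\<forall>g\<in>S k. \<not> (\<forall>i\<in>J g. b i = c t i))}"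
  let ?r = "(1 - (1/2) ^ d) ^ (2 ^ scale k) :: real"
  have cardK: "card K = k"
    unfolding K_def by (subst card_image, simp add: inj_on_def)+ simp
  have finK: "finite K" "K \<subseteq> sites" using w by (auto simp: K_def)
  have cardJ: "card (J g) = d" for g
  proof -
    have "card (J g) = card (Mem (Suc k) ` {..<depth (Suc k)} \<union> Lab (Suc k) ` {..<k})"
      unfolding J_def by (intro card_image) (simp add: inj_on_def)
    also have "\<dots> = card (Mem (Suc k) ` {..<depth (Suc k)}) + card (Lab (Suc k) ` {..<k})"
      by (intro card_Un_disjoint) auto
    also have "\<dots> = d" unfolding d_def by (subst (1 2) card_image) (simp_all add: inj_on_def)
    finally show ?thesis .
  qed
  have finJ: "finite (J g)" for g by (simp add: J_def)
  have subJ: "J g \<subseteq> sites" if "g \<in> S k" for g using mult_S_carrier[OF w that] by (auto simp: J_def)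
  \<comment> \<open>The label coins of \<open>w\<close> and of its candidates belong to different
    levels, so the case \<open>w \<otimes> g = w\<close> is included.\<close>
  have KJ: "K \<inter> J g = {}" for g by (auto simp: K_def J_def)
  have disj: "disjoint_family_on J (S k)"
    unfolding disjoint_family_on_def
  proof (intro ballI impI)
    fix g h assume gh: "g \<in> S k" "h \<in> S k" "g \<noteq> h"
    then have "w \<otimes> g \<noteq> w \<otimes> h" using w S_carrier[of k] by (simp add: subset_iff)
    then show "J g \<inter> J h = {}" by (auto simp: J_def)
  qed
  have E: "prob (?E t) = (1/2) ^ k * ?r" for t
  proof -
    have "prob (?E t) = (1/2) ^ card K * (1 - (1/2) ^ d) ^ card (S k)"
      by (intro measure_coins_avoid finite_S finK disj conjI finJ subJ cardJ KJ)
    then show ?thesis by (simp add: cardK card_S)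
  qed
  have meas: "?E t \<in> events" for t
  proof -
    have "Measurable.pred law (\<lambda>b. (\<forall>i\<in>K. b i = c t i) \<and> (\<forall>g\<in>S k. \<not> (\<forall>i\<in>J g. b i = c t i)))"
      using finK finJ subJ by (intro pred_intros_logic pred_intros_finite(3) pred_cylinder finite_S)
    then show ?thesis by (simp add: pred_def)
  qed
  have finT: "finite T" and cardT: "card T = 2 ^ k"
    by (auto simp: T_def card_PiE intro!: finite_PiE)
  have "{b \<in> space law. targets b k w = {}} \<subseteq> (\<Union>t\<in>T. ?E t)"
  proof
    fix b assume b: "b \<in> {b \<in> space law. targets b k w = {}}"
    define t where "t = restrict (\<lambda>j. b (w, Lab k j)) {..<k}"
    have "t \<in> T" by (simp add: t_def T_def)
    moreover have "b \<in> ?E t"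
    proof (intro CollectI conjI ballI notI)
      show "b \<in> space law" using b by simp
      show "b i = c t i" if "i \<in> K" for i using that by (auto simp: K_def c_def t_def)
      fix g assume g: "g \<in> S k" and all: "\<forall>i\<in>J g. b i = c t i"
      have "in_level b (Suc k) (w \<otimes> g)"
        unfolding in_level_def using all by (auto simp: J_def c_def ball_Un)
      moreover have "b (w \<otimes> g, Lab (Suc k) j) = b (w, Lab k j)" if "j < k" for j
        using all that by (auto simp: J_def c_def t_def ball_Un)
      ultimately have "g \<in> targets b k w" using g unfolding targets_def by blast
      then show False using b by simp
    qed
    ultimately show "b \<in> (\<Union>t\<in>T. ?E t)" by blast
  qed
  then have "prob {b \<in> space law. targets b k w = {}} \<le> prob (\<Union>t\<in>T. ?E t)"
    using meas finT by (intro finite_measure_mono) auto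
  also have "\<dots> \<le> real (2 ^ k) * ((1/2) ^ k * ?r)"
    using finT cardT meas E by (intro prob_finite_Union_le) (auto simp: power_le_one)
  also have "\<dots> = ?r" by (simp add: power_one_over)
  also have "\<dots> \<le> exp (- ((1/2) ^ d)) ^ (2 ^ scale k)"
    using exp_ge_add_one_self[of "- ((1/2::real) ^ d)"] by (intro power_mono) (auto simp: power_le_one)
  also have "\<dots> = exp (- real (scale k))"
  proof -
    \<comment> \<open>Hence the expected number of successes is \<open>2 ^ (2 * k + 8)\<close>,
      which is \<open>scale k\<close> by definition.\<close>
    have "d + (2 * k + 8) = scale k" using depth_Suc_slack[of k] by (simp add: d_def slack_def)
    then have "(2::real) ^ scale k = 2 ^ d * 2 ^ (2 * k + 8)" by (simp flip: power_add)
    then have "(2::real) ^ scale k * (1/2) ^ d = real (scale k)"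
      by (simp add: scale_def power_one_over)
    then show ?thesis by (simp add: exp_of_nat_mult[symmetric])
  qed
  also have "\<dots> = exp (- 1) ^ scale k" by (simp add: exp_of_nat_mult[symmetric])
  also have "\<dots> \<le> (1/2) ^ scale k"
  proof (rule power_mono)
    have "(2::real) \<le> exp 1" using exp_ge_add_one_self[of 1] by simp
    then show "exp (- 1) \<le> (1/2 :: real)" by (simp add: exp_minus field_simps)
  qed simp
  finally show ?thesis .
qed

text \<open>
  Since \<open>w p = z q\<close> at a crossing point, \<open>z\<close> is determined by \<open>w\<close>, \<open>p\<close> and \<open>q\<close>. This replaces a count of
  the paths through a given vertex.
\<close>

definition hits :: "('g \<times> coin_index \<Rightarrow> bool) \<Rightarrow> nat \<Rightarrow> nat \<Rightarrow> 'g \<Rightarrow> 'g \<Rightarrow> 'g \<Rightarrow> 'g \<Rightarrow> 'g \<Rightarrow> bool" where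
  "hits b k m w g h p q \<longleftrightarrow> (let z = w \<otimes> p \<otimes> inv q in
     in_level b k w \<and> in_level b (Suc k) (w \<otimes> g) \<and> in_level b m z \<and> in_level b (Suc m) (z \<otimes> h) \<and>
     (m, z) \<noteq> (k, w) \<and> (m, z) \<noteq> (Suc k, w \<otimes> g) \<and> (m, z \<otimes> h) \<noteq> (k, w \<otimes> g))"

lemma clash_hits:
  assumes w: "w \<in> carrier \<Gamma>" and g: "g \<in> S k"
    and lev: "in_level b k w" "in_level b (Suc k) (w \<otimes> g)" and "clash b k w g"
  shows "\<exists>l. \<exists>h\<in>S (k + l). \<exists>p\<in>P k g. \<exists>q\<in>P (k + l) h. hits b k (k + l) w g h p q"
proof -
  from \<open>clash b k w g\<close> obtain m z h v where m: "k \<le> m" and z: "z \<in> carrier \<Gamma>" and h: "h \<in> S m"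
    and lz: "in_level b m z" "in_level b (Suc m) (z \<otimes> h)"
    and v: "v \<in> route m z h" "v \<in> route k w g"
    and ne: "(m, z) \<noteq> (k, w)" "(m, z) \<noteq> (Suc k, w \<otimes> g)" "(m, z \<otimes> h) \<noteq> (k, w \<otimes> g)"
    unfolding clash_def by blast
  obtain p q where p: "p \<in> P k g" "v = w \<otimes> p" and q: "q \<in> P m h" "v = z \<otimes> q"
    using v unfolding route_def by blast
  have "q \<in> carrier \<Gamma>" using q P_carrier[OF h] by blast
  then have "w \<otimes> p \<otimes> inv q = z" using p q z by (metis inv_solve_right m_closed)
  then have "hits b k m w g h p q" using lev lz ne unfolding hits_def by simp
  then show ?thesis using m h p q by (intro exI[of _ "m - k"]) auto
qed

lemma hits_prob:
  assumes "1 \<le> k" "k \<le> m" and w: "w \<in> carrier \<Gamma>" and g: "g \<in> S k" and h: "h \<in> S m"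
    and p: "p \<in> P k g" and q: "q \<in> P m h"
  shows "{b \<in> space law. hits b k m w g h p q} \<in> sets law \<and>
    measure law {b \<in> space law. hits b k m w g h p q}
      \<le> (1/2) ^ (depth k + depth (Suc k) + depth m + depth (Suc m))"
proof -
  define z where "z = w \<otimes> p \<otimes> inv q"
  have z: "z \<in> carrier \<Gamma>" using w p q P_carrier[OF g] P_carrier[OF h] unfolding z_def by auto
  note c = w mult_S_carrier[OF w g] z mult_S_carrier[OF z h]
  let ?F = "{b \<in> space law. in_level b k w \<and> in_level b (Suc k) (w \<otimes> g) \<and> in_level b m z \<and> in_level b (Suc m) (z \<otimes> h)}"
  show ?thesis
  proof (cases "(m, z) \<noteq> (k, w) \<and> (m, z) \<noteq> (Suc k, w \<otimes> g) \<and> (m, z \<otimes> h) \<noteq> (k, w \<otimes> g)")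
    case True
    then have eq: "{b \<in> space law. hits b k m w g h p q} = ?F"
      unfolding hits_def z_def[symmetric] Let_def by simp
    have "Measurable.pred law (\<lambda>b. in_level b k w \<and> in_level b (Suc k) (w \<otimes> g) \<and> in_level b m z \<and> in_level b (Suc m) (z \<otimes> h))"
      by (intro pred_intros_logic pred_in_level c)
    \<comment> \<open>The three exclusions in \<open>hits\<close> together with
      \<open>k \<le> m\<close> make the four pairs of level and vertex distinct, so that disjoint
      sets of coins decide them.\<close>
    moreover have "distinct [(k, w), (Suc k, w \<otimes> g), (m, z), (Suc m, z \<otimes> h)]"
      using True assms(2) by auto
    ultimately show ?thesis
      unfolding eq using prob_four_levels[OF c] by (simp add: pred_def)
  next
    case False
    then have eq: "{b \<in> space law. hits b k m w g h p q} = {}"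
      unfolding hits_def z_def[symmetric] Let_def by blast
    show ?thesis unfolding eq by simp
  qed
qed

definition crash :: "('g \<times> coin_index \<Rightarrow> bool) \<Rightarrow> nat \<Rightarrow> 'g set \<Rightarrow> bool" where
  "crash b k W \<longleftrightarrow> (\<exists>w\<in>W. \<exists>g\<in>S k. in_level b k w \<and> in_level b (Suc k) (w \<otimes> g) \<and> clash b k w g)"

text \<open>The union runs over \<open>w\<close>, both relative endpoints and both positions of the
  crossing point. The gain in \<open>clash_exponent\<close> makes the bounds summable over
  \<open>m = k + l\<close>. At \<open>k = 0\<close> that exponent estimate fails, since level 0 has
  density one.\<close>

lemma crash_prob:
  assumes "1 \<le> k" and W: "finite W" "W \<subseteq> carrier \<Gamma>" "card W \<le> 2 ^ scale_sum k"
  shows "measure law {b \<in> space law. crash b k W} \<le> 2 * (1/2) ^ k"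
proof -
  interpret prob_space law by (rule prob_space_coins)
  define e where "e l = (1/2::real) ^ (depth k + depth (Suc k) + depth (k + l) + depth (Suc (k + l)))" for l
  have e: "0 \<le> e l" for l by (simp add: e_def)
  let ?H = "\<lambda>l w g h p q. {b \<in> space law. hits b k (k + l) w g h p q}"
  let ?U = "\<lambda>l. \<Union>w\<in>W. \<Union>g\<in>S k. \<Union>h\<in>S (k + l). \<Union>p\<in>P k g. \<Union>q\<in>P (k + l) h. ?H l w g h p q"
  have U: "?U l \<in> events \<and> prob (?U l) \<le> (1/2) ^ k * (1/2) ^ l" for l
  proof -
    let ?m = "k + l"
    \<comment> \<open>\<open>N1\<close> to \<open>N4\<close> bound the nested unions from the
      inside: over \<open>q\<close>, \<open>p\<close>, \<open>h\<close> and \<open>g\<close>. The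
      factor for \<open>w\<close> comes last.\<close>
    define N1 where "N1 = real (Suc (scale ?m)) * e l"
    define N2 where "N2 = real (Suc (scale k)) * N1"
    define N3 where "N3 = real (2 ^ scale ?m) * N2"
    define N4 where "N4 = real (2 ^ scale k) * N3"
    have nn: "0 \<le> N1" "0 \<le> N2" "0 \<le> N3" "0 \<le> N4" using e by (simp_all add: N1_def N2_def N3_def N4_def)
    have 0: "?H l w g h p q \<in> events \<and> prob (?H l w g h p q) \<le> e l"
      if "w \<in> W" "g \<in> S k" "h \<in> S ?m" "p \<in> P k g" "q \<in> P ?m h" for w g h p q
      using hits_prob[OF assms(1), of ?m w g h p q] that W unfolding e_def by auto
    have 1: "(\<Union>q\<in>P ?m h. ?H l w g h p q) \<in> events \<and> prob (\<Union>q\<in>P ?m h. ?H l w g h p q) \<le> N1"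
      if "w \<in> W" "g \<in> S k" "h \<in> S ?m" "p \<in> P k g" for w g h p
      unfolding N1_def
      by (intro conjI sets.finite_UN prob_finite_Union_le e)
        (use 0 that finite_P[of h ?m] card_P[of h ?m] in auto)
    have 2: "(\<Union>p\<in>P k g. \<Union>q\<in>P ?m h. ?H l w g h p q) \<in> events \<and>
        prob (\<Union>p\<in>P k g. \<Union>q\<in>P ?m h. ?H l w g h p q) \<le> N2"
      if "w \<in> W" "g \<in> S k" "h \<in> S ?m" for w g h
      unfolding N2_def
      by (intro conjI sets.finite_UN[where I = "P k g"] prob_finite_Union_le nn)
        (use 1 that finite_P[of g k] card_P[of g k] in auto)
    have 3: "(\<Union>h\<in>S ?m. \<Union>p\<in>P k g. \<Union>q\<in>P ?m h. ?H l w g h p q) \<in> events \<and>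
        prob (\<Union>h\<in>S ?m. \<Union>p\<in>P k g. \<Union>q\<in>P ?m h. ?H l w g h p q) \<le> N3"
      if "w \<in> W" "g \<in> S k" for w g
      unfolding N3_def
      by (intro conjI sets.finite_UN[where I = "S ?m"] prob_finite_Union_le nn)
        (use 2 that finite_S[of ?m] card_S[of ?m] in auto)
    have 4: "(\<Union>g\<in>S k. \<Union>h\<in>S ?m. \<Union>p\<in>P k g. \<Union>q\<in>P ?m h. ?H l w g h p q) \<in> events \<and>
        prob (\<Union>g\<in>S k. \<Union>h\<in>S ?m. \<Union>p\<in>P k g. \<Union>q\<in>P ?m h. ?H l w g h p q) \<le> N4"
      if "w \<in> W" for w
      unfolding N4_def
      by (intro conjI sets.finite_UN[where I = "S k"] prob_finite_Union_le nn)
        (use 3 that finite_S[of k] card_S[of k] in auto)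
    have 5: "?U l \<in> events \<and> prob (?U l) \<le> real (2 ^ scale_sum k) * N4"
      by (intro conjI sets.finite_UN[where I = W] prob_finite_Union_le nn)
        (use 4 W in auto)
    have size: "real (Suc (scale n)) \<le> 2 ^ (2 * n + 9)" for n
    proof -
      have "Suc (scale n) \<le> 2 * scale n" using scale_eq_scale_sum[of n] by simp
      also have "\<dots> = 2 ^ (2 * n + 9)" by (simp add: scale_def power_add)
      finally show ?thesis by (metis of_nat_le_iff of_nat_numeral of_nat_power)
    qed
    have "N1 \<le> 2 ^ (2 * ?m + 9) * e l"
      unfolding N1_def by (rule mult_right_mono[OF size e])
    then have "N2 \<le> 2 ^ (2 * k + 9) * (2 ^ (2 * ?m + 9) * e l)"
      unfolding N2_def using nn by (intro mult_mono size) auto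
    then have "real (2 ^ scale_sum k) * N4 \<le> 2 ^ scale_sum k * (2 ^ scale k * (2 ^ scale ?m * (2 ^ (2 * k + 9) * (2 ^ (2 * ?m + 9) * e l))))"
      unfolding N4_def N3_def by simp
    also have "\<dots> = 2 ^ (scale_sum k + scale k + scale ?m + (2 * k + 9) + (2 * ?m + 9)) * e l"
      by (simp only: power_add mult.assoc)
    also have "\<dots> \<le> (1/2) ^ (k + ?m)"
    proof -
      let ?a = "scale_sum k + scale k + scale ?m + (2 * k + 9) + (2 * ?m + 9)"
      let ?d = "depth k + depth (Suc k) + depth ?m + depth (Suc ?m)"
      have le: "?a + (k + ?m) \<le> ?d" using clash_exponent[of k ?m] assms(1) by simp
      have "(2::real) ^ ?a * (1/2) ^ ?d \<le> 2 ^ ?a * (1/2) ^ (?a + (k + ?m))"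
        using le by (intro mult_left_mono power_decreasing) auto
      also have "\<dots> = (1/2) ^ (k + ?m)" by (rule two_power_half_power)
      finally show ?thesis unfolding e_def .
    qed
    also have "\<dots> \<le> (1/2) ^ (k + l)" by (intro power_decreasing) auto
    finally show ?thesis using 5 by (simp add: power_add)
  qed
  have "{b \<in> space law. crash b k W} \<subseteq> (\<Union>l. ?U l)"
  proof
    fix b assume b: "b \<in> {b \<in> space law. crash b k W}"
    then obtain w g where wg: "w \<in> W" "g \<in> S k" "in_level b k w" "in_level b (Suc k) (w \<otimes> g)" "clash b k w g"
      unfolding crash_def by blast
    then have "\<exists>l. \<exists>h\<in>S (k + l). \<exists>p\<in>P k g. \<exists>q\<in>P (k + l) h. hits b k (k + l) w g h p q"
      using W by (intro clash_hits) auto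
    then show "b \<in> (\<Union>l. ?U l)" using b wg by blast
  qed
  then have "prob {b \<in> space law. crash b k W} \<le> prob (\<Union>l. ?U l)"
    using U by (intro finite_measure_mono sets.countable_UN) auto
  also have "\<dots> \<le> 2 * (1/2) ^ k" using U by (intro prob_Union_geometric_le) auto
  finally show ?thesis .
qed

definition miss :: "('g \<times> coin_index \<Rightarrow> bool) \<Rightarrow> nat \<Rightarrow> 'g set \<Rightarrow> bool" where
  "miss b k W \<longleftrightarrow> (\<exists>w\<in>W. targets b k w = {})"

text \<open>At most \<open>2 ^ scale_sum k\<close> vertices compete with a failure probability of
  \<open>(1/2) ^ scale k\<close>, and \<open>scale k\<close> exceeds
  \<open>scale_sum k + k\<close>.\<close>

lemma miss_prob:
  assumes W: "finite W" "W \<subseteq> carrier \<Gamma>" "card W \<le> 2 ^ scale_sum k"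
  shows "measure law {b \<in> space law. miss b k W} \<le> (1/2) ^ k"
proof -
  interpret prob_space law by (rule prob_space_coins)
  have "{b \<in> space law. miss b k W} = (\<Union>w\<in>W. {b \<in> space law. targets b k w = {}})"
    by (auto simp: miss_def)
  also have "prob \<dots> \<le> real (2 ^ scale_sum k) * (1/2) ^ scale k"
    using W prob_targets_empty pred_targets[of _ "\<lambda>T. T = {}" k]
    by (intro prob_finite_Union_le) (auto simp: pred_def subset_iff)
  also have "\<dots> \<le> 2 ^ scale_sum k * (1/2) ^ (scale_sum k + k)"
    using scale_eq_scale_sum[of k] le_scale_sum[of k] by (intro mult_mono power_decreasing) auto
  also have "\<dots> = (1/2) ^ k" by (simp add: power_add power_one_over)
  finally show ?thesis .
qed

text \<open>The vertex \<open>\<one>\<close> need not lie in level \<open>n\<close>, so the good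
  chain begins one step later. From there on each vertex has its level because it was a target of
  its predecessor.\<close>

lemma good_if_no_failure:
  assumes miss: "\<And>i. \<not> miss b (n + i) (reach n i)"
    and crash: "\<And>i. \<not> crash b (n + Suc i) (reach n (Suc i))"
  shows "good b (Suc n) (chain b n \<one> 1)"
  unfolding good_def
proof
  fix i
  let ?y = "chain b n \<one>" and ?k = "n + Suc i"
  have T: "targets b (n + j) (?y j) \<noteq> {}" for j
    using miss[of j] chain_reach[of b n j] unfolding miss_def by blast
  then have lev: "in_level b (n + Suc j) (?y (Suc j))" for j
    using pick_in_nonempty[OF T[of j]] by (simp add: targets_def)
  have lev': "in_level b (Suc ?k) (?y (Suc i) \<otimes> step b ?k (?y (Suc i)))"
    using pick_in_nonempty[OF T[of "Suc i"]] by (simp add: targets_def del: chain.simps)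
  have "\<not> clash b ?k (?y (Suc i)) (step b ?k (?y (Suc i)))"
    using crash[of i] chain_reach[of b n "Suc i"] step_in[of ?k b "?y (Suc i)"] lev[of i] lev'
    unfolding crash_def by (auto simp del: chain.simps reach.simps)
  then have "clear b ?k (?y (Suc i))" using T[of "Suc i"] lev[of i] unfolding clear_def by blast
  moreover have "chain b (Suc n) (?y 1) i = ?y (Suc i)" by (subst chain_Suc_front) simp
  ultimately show "clear b (Suc n + i) (chain b (Suc n) (?y 1) i)" by (simp del: chain.simps)
qed

lemma pred_crash_miss:
  assumes "finite W" "W \<subseteq> carrier \<Gamma>"
  shows "Measurable.pred law (\<lambda>b. crash b k W)" "Measurable.pred law (\<lambda>b. miss b k W)"
proof -
  show "Measurable.pred law (\<lambda>b. crash b k W)"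
    unfolding crash_def
    by (intro pred_intros_finite(4) pred_intros_logic pred_in_level pred_clash finite_S assms(1) mult_S_carrier)
      (use assms(2) in auto)
  show "Measurable.pred law (\<lambda>b. miss b k W)"
    unfolding miss_def
  proof (rule pred_intros_finite(4)[OF assms(1)])
    fix w assume "w \<in> W"
    then show "Measurable.pred law (\<lambda>b. targets b k w = {})"
      using assms(2) pred_targets[of w "\<lambda>T. T = {}"] by auto
  qed
qed

text \<open>The event does not mention the starting level \<open>n\<close>, while the failure bound
  \<open>4 * (1/2) ^ n\<close> holds for each \<open>n\<close>. Letting \<open>n\<close> grow gives
  probability zero without an ergodicity argument.\<close>

lemma AE_good: "AE b in law. \<exists>k. \<exists>x\<in>carrier \<Gamma>. good b k x"
proof -
  interpret prob_space law by (rule prob_space_coins)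
  let ?N = "{b \<in> space law. \<not> (\<exists>k. \<exists>x\<in>carrier \<Gamma>. good b k x)}"
  have "Measurable.pred law (\<lambda>b. \<not> (\<exists>k. \<exists>x\<in>carrier \<Gamma>. good b k x))"
    by (intro pred_intros_logic pred_intros_countable(2) pred_countable_bex countable_carrier pred_good)
  then have N: "?N \<in> events" unfolding pred_def .
  have "prob ?N \<le> 4 * (1/2) ^ n" for n
  proof -
    let ?F = "\<lambda>i. {b \<in> space law. miss b (n + i) (reach n i)} \<union>
      {b \<in> space law. crash b (n + Suc i) (reach n (Suc i))}"
    have F: "?F i \<in> events \<and> prob (?F i) \<le> (2 * (1/2) ^ n) * (1/2) ^ i" for i
    proof -
      have 1: "{b \<in> space law. miss b (n + i) (reach n i)} \<in> events"
        "{b \<in> space law. crash b (n + Suc i) (reach n (Suc i))} \<in> events"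
        using pred_crash_miss[OF finite_reach reach_carrier] unfolding pred_def by blast+
      have "prob (?F i) \<le> prob {b \<in> space law. miss b (n + i) (reach n i)} +
          prob {b \<in> space law. crash b (n + Suc i) (reach n (Suc i))}"
        using 1 by (rule measure_Un_le)
      also have "\<dots> \<le> (1/2) ^ (n + i) + 2 * (1/2) ^ (n + Suc i)"
        by (intro add_mono miss_prob crash_prob finite_reach reach_carrier card_reach) auto
      also have "\<dots> = (2 * (1/2) ^ n) * (1/2) ^ i" by (simp add: power_add)
      finally show ?thesis using 1 by blast
    qed
    have "?N \<subseteq> (\<Union>i. ?F i)"
    proof
      fix b assume b: "b \<in> ?N"
      show "b \<in> (\<Union>i. ?F i)"
      proof (rule ccontr)
        assume "b \<notin> (\<Union>i. ?F i)"
        then have "good b (Suc n) (chain b n \<one> 1)" using b by (intro good_if_no_failure) auto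
        moreover have "chain b n \<one> 1 \<in> carrier \<Gamma>" by simp
        ultimately show False using b by blast
      qed
    qed
    then have "prob ?N \<le> prob (\<Union>i. ?F i)"
      using F by (intro finite_measure_mono sets.countable_UN) auto
    also have "\<dots> \<le> 2 * (2 * (1/2) ^ n)" using F by (intro prob_Union_geometric_le) auto
    finally show ?thesis by simp
  qed
  moreover have "(\<lambda>n. 4 * (1/2::real) ^ n) \<longlonglongrightarrow> 4 * 0"
    by (intro tendsto_intros LIMSEQ_power_zero) simp
  ultimately have "prob ?N \<le> 0"
    by (intro LIMSEQ_le_const[of "\<lambda>n. 4 * (1/2) ^ n"]) auto
  then have "emeasure law ?N = 0" by (simp add: emeasure_eq_measure measure_le_0_iff)
  then show ?thesis using N by (intro AE_I[of _ _ ?N]) auto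
qed

end

section \<open>The factor map\<close>

text \<open>One uniform variable supplies all coins of its vertex. Since \<open>to_nat\<close> is
  only known to be injective, the digits in use may sit at arbitrary positions, which is why
  \<open>measure_digits\<close> treats arbitrary finite sets.\<close>

definition encode :: "('g, 'm) monoid_scheme \<Rightarrow> ('g \<Rightarrow> real) \<Rightarrow> 'g \<times> coin_index \<Rightarrow> bool" where
  "encode G \<omega> = (\<lambda>(x, i)\<in>carrier G \<times> UNIV. digit (\<omega> x) (to_nat i))"

interpretation uniform: product_prob_space "\<lambda>_. unit_uniform" I for I :: "'g set"
  by (intro product_prob_spaceI prob_space_unit_uniform)

lemma pred_encode:
  assumes "y \<in> carrier G \<times> UNIV"
  shows "Measurable.pred (iid_uniform G) (\<lambda>\<omega>. encode G \<omega> y)"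
proof -
  obtain x i where y: "y = (x, i)" "x \<in> carrier G" using assms by auto
  have "(\<lambda>\<omega>. \<omega> x) \<in> iid_uniform G \<rightarrow>\<^sub>M unit_uniform"
    unfolding iid_uniform_def by (rule measurable_component_singleton[OF y(2)])
  from measurable_compose[OF this measurable_digit[of "to_nat i"]]
  show ?thesis by (simp add: encode_def y)
qed

lemma measurable_encode: "encode G \<in> iid_uniform G \<rightarrow>\<^sub>M coins (carrier G \<times> UNIV)"
  by (rule measurable_coinsI) (rule pred_encode, auto simp: encode_def)

lemma distr_encode: "distr (iid_uniform G) (coins (carrier G \<times> UNIV)) (encode G) = coins (carrier G \<times> UNIV)"
proof (rule coins_eqI)
  interpret prob_space "iid_uniform G"
    unfolding iid_uniform_def by (rule uniform.P.prob_space_axioms)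
  show "prob_space (distr (iid_uniform G) (coins (carrier G \<times> UNIV)) (encode G))"
    by (rule prob_space_distr[OF measurable_encode])
  fix J :: "('a \<times> coin_index) set" and c :: "'a \<times> coin_index \<Rightarrow> bool"
  assume J: "finite J" "J \<subseteq> carrier G \<times> UNIV"
  let ?I = "coins (carrier G \<times> UNIV)"
  \<comment> \<open>The cylinder condition sorted by vertices: \<open>X x\<close> collects what it
    demands of the single variable at \<open>x\<close>, and different vertices are
    independent.\<close>
  define X where "X x = {u \<in> space unit_uniform. \<forall>n\<in>to_nat ` {i. (x, i) \<in> J}. digit u n = c (x, from_nat n)}" for x
  have fin: "finite {i. (x, i) \<in> J}" for x
  proof (rule finite_subset)
    show "{i. (x, i) \<in> J} \<subseteq> snd ` J"
      by (auto intro: rev_image_eqI)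
    show "finite (snd ` J)" using J by simp
  qed
  have X: "X x \<in> sets unit_uniform" for x
  proof -
    have "Measurable.pred unit_uniform (\<lambda>u. \<forall>n\<in>to_nat ` {i. (x, i) \<in> J}. digit u n = c (x, from_nat n))"
      using fin[of x] by (intro pred_intros_finite(3)) (simp_all add: measurable_digit)
    then show ?thesis unfolding X_def pred_def .
  qed
  have PX: "measure unit_uniform (X x) = (1/2) ^ card {i. (x, i) \<in> J}" for x
  proof -
    have "measure unit_uniform (X x) = (1/2) ^ card (to_nat ` {i. (x, i) \<in> J})"
      unfolding X_def by (rule measure_digits) (simp add: fin)
    then show ?thesis by (simp add: card_image)
  qed
  have E: "{b \<in> space ?I. \<forall>y\<in>J. b y = c y} \<in> sets ?I"
    using pred_cylinder[OF J] by (simp add: pred_def)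
  have "encode G -` {b \<in> space ?I. \<forall>y\<in>J. b y = c y} \<inter> space (iid_uniform G)
      = {\<omega> \<in> space (iid_uniform G). \<forall>x\<in>fst ` J. \<omega> x \<in> X x}" (is "?L = ?R")
  proof (intro equalityI subsetI)
    fix \<omega> assume "\<omega> \<in> ?L"
    then have w: "\<omega> \<in> space (iid_uniform G)" "\<And>y. y \<in> J \<Longrightarrow> encode G \<omega> y = c y" by blast+
    have "\<omega> x \<in> X x" if "x \<in> fst ` J" for x
    proof -
      have x: "x \<in> carrier G" using that J by auto
      then have "\<omega> x \<in> space unit_uniform" using w(1) by (auto simp: iid_uniform_def space_PiM)
      moreover have "digit (\<omega> x) (to_nat i) = c (x, i)" if "(x, i) \<in> J" for i
        using w(2)[OF that] x by (simp add: encode_def)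
      ultimately show ?thesis unfolding X_def by simp
    qed
    then show "\<omega> \<in> ?R" using w(1) by blast
  next
    fix \<omega> assume w: "\<omega> \<in> ?R"
    have "encode G \<omega> (x, i) = c (x, i)" if xi: "(x, i) \<in> J" for x i
    proof -
      have "x \<in> fst ` J" using xi by (rule rev_image_eqI) simp
      then have "\<omega> x \<in> X x" using w by blast
      then have "digit (\<omega> x) (to_nat i) = c (x, i)" using xi unfolding X_def by simp
      moreover have "x \<in> carrier G" using xi J by blast
      ultimately show ?thesis by (simp add: encode_def)
    qed
    then have "\<forall>y\<in>J. encode G \<omega> y = c y" by (metis surj_pair)
    moreover have "encode G \<omega> \<in> space ?I" using w by (intro measurable_space[OF measurable_encode]) blast
    ultimately show "\<omega> \<in> ?L" using w by blast
  qed
  moreover have "prob ?R = (\<Prod>x\<in>fst ` J. measure unit_uniform (X x))"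
  proof -
    have "emeasure (iid_uniform G) ?R = (\<Prod>x\<in>fst ` J. emeasure unit_uniform (X x))"
      unfolding iid_uniform_def using J X by (intro uniform.emeasure_PiM_Collect) auto
    then show ?thesis
      by (simp add: emeasure_eq_measure uniform.M.emeasure_eq_measure prod_ennreal prod_nonneg)
  qed
  moreover have "(\<Prod>x\<in>fst ` J. measure unit_uniform (X x)) = (1/2) ^ (\<Sum>x\<in>fst ` J. card {i. (x, i) \<in> J})"
    unfolding PX by (rule power_sum[symmetric])
  moreover have "(\<Sum>x\<in>fst ` J. card {i. (x, i) \<in> J}) = card J"
  proof -
    have "J = (SIGMA x:fst ` J. {i. (x, i) \<in> J})"
      by (auto intro: rev_image_eqI)
    then have "card J = card (SIGMA x:fst ` J. {i. (x, i) \<in> J})" by (rule arg_cong)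
    also have "\<dots> = (\<Sum>x\<in>fst ` J. card {i. (x, i) \<in> J})"
      using J fin by (intro card_SigmaI) blast+
    finally show ?thesis by simp
  qed
  ultimately show "measure (distr (iid_uniform G) ?I (encode G)) {b \<in> space (distr (iid_uniform G) ?I (encode G)). \<forall>y\<in>J. b y = c y} = (1/2) ^ card J"
    unfolding space_distr measure_distr[OF measurable_encode E] by simp
qed simp

section \<open>From equally labelled connected sets to clusters\<close>

lemma infinite_cluster:
  assumes "symmetric (with_proj T)" and "parcs T \<subseteq> pverts T \<times> pverts T"
    and x: "x \<in> pverts T" and U: "infinite U"
    and reach: "\<And>u. u \<in> U \<Longrightarrow> (x, u) \<in> {(u, w) \<in> parcs T. L u = L w}\<^sup>*"
  shows "\<exists>C\<in>clusters T L. infinite (verts C)"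
proof -
  interpret sym: pair_sym_digraph "clust T L"
    using assms(1,2) by unfold_locales (auto simp: clust_def symmetric_def sym_def)
  let ?C = "with_proj (clust T L) \<restriction> {v. x \<rightarrow>\<^sup>*\<^bsub>with_proj (clust T L)\<^esub> v}"
  have verts: "x \<in> pverts (clust T L)" using x by (simp add: clust_def)
  have "?C \<in> clusters T L"
    unfolding clusters_def using sym.induce_reachable_is_in_sccs verts by simp
  moreover have "U \<subseteq> verts ?C"
  proof
    fix u assume "u \<in> U"
    then have "(x, u) \<in> {(u, w) \<in> parcs T. L u = L w}\<^sup>*" by (rule reach)
    then have "x \<rightarrow>\<^sup>*\<^bsub>with_proj (clust T L)\<^esub> u"
    proof (induction rule: rtrancl_induct)
      case base
      show ?case using verts by (rule sym.reachable_refl)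
    next
      case (step u w)
      have "(u, w) \<in> parcs (clust T L)" using step(2) by (simp add: clust_def)
      with step(3) show ?case by (rule sym.reachable_adj_trans)
    qed
    then show "u \<in> verts ?C" by simp
  qed
  ultimately show ?thesis using U infinite_super by blast
qed

section \<open>The labeling as a factor of the uniform variables\<close>

context path_system
begin

definition labeling :: "('g \<Rightarrow> real) \<Rightarrow> 'g \<Rightarrow> real" where
  "labeling \<omega> = (\<lambda>v\<in>carrier \<Gamma>. bin_value (lab (encode \<Gamma> \<omega>) v))"

lemma measurable_labeling:
  assumes "v \<in> carrier \<Gamma>"
  shows "(\<lambda>\<omega>. labeling \<omega> v) \<in> iid_uniform \<Gamma> \<rightarrow>\<^sub>M unit_borel"
  using measurable_compose[OF measurable_encode measurable_compose[OF measurable_lab[OF assms] measurable_bin_value]] assms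
  by (simp add: labeling_def)

lemma twisted_encode:
  assumes "a \<in> carrier \<Gamma>"
  shows "twisted (inv a) (\<lambda>_. False) (encode \<Gamma> \<omega>) (encode \<Gamma> (shift \<Gamma> a \<omega>))"
  using assms by (simp add: twisted_def encode_def shift_def)

lemma FIID_labeling_labeling: "FIID_labeling \<Gamma> unit_borel labeling"
  unfolding FIID_labeling_def
proof (intro conjI ballI)
  have "(\<lambda>\<omega> v. if v \<in> carrier \<Gamma> then labeling \<omega> v else undefined) \<in> iid_uniform \<Gamma> \<rightarrow>\<^sub>M (\<Pi>\<^sub>M v\<in>carrier \<Gamma>. unit_borel)"
  proof (rule measurable_PiM_single')
    show "(\<lambda>\<omega>. if v \<in> carrier \<Gamma> then labeling \<omega> v else undefined) \<in> iid_uniform \<Gamma> \<rightarrow>\<^sub>M unit_borel"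
      if "v \<in> carrier \<Gamma>" for v
      using measurable_labeling[OF that] that by simp
    show "(\<lambda>\<omega> v. if v \<in> carrier \<Gamma> then labeling \<omega> v else undefined) \<in> space (iid_uniform \<Gamma>) \<rightarrow> (\<Pi>\<^sub>E v\<in>carrier \<Gamma>. space unit_borel)"
      using measurable_space[OF measurable_labeling] by (auto simp: PiE_iff extensional_def)
  qed
  moreover have "labeling = (\<lambda>\<omega> v. if v \<in> carrier \<Gamma> then labeling \<omega> v else undefined)"
    by (auto simp: labeling_def fun_eq_iff)
  ultimately show "labeling \<in> iid_uniform \<Gamma> \<rightarrow>\<^sub>M (\<Pi>\<^sub>M v\<in>carrier \<Gamma>. unit_borel)" by simp
next
  fix a \<omega> assume a: "a \<in> carrier \<Gamma>"
  show "labeling (shift \<Gamma> a \<omega>) = shift \<Gamma> a (labeling \<omega>)"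
  proof
    fix v
    show "labeling (shift \<Gamma> a \<omega>) v = shift \<Gamma> a (labeling \<omega>) v"
    proof (cases "v \<in> carrier \<Gamma>")
      case True
      have "lab (encode \<Gamma> (shift \<Gamma> a \<omega>)) v = lab (encode \<Gamma> \<omega>) (inv a \<otimes> v)"
        using twisted_lab[OF _ twisted_encode[OF a] True] a by (simp add: fun_eq_iff)
      then show ?thesis using True a by (simp add: labeling_def shift_def)
    qed (simp add: labeling_def shift_def)
  qed
qed

lemma marginal_labeling:
  assumes v: "v \<in> carrier \<Gamma>"
  shows "marginal \<Gamma> unit_borel labeling v = unit_uniform"
proof -
  note lab = measurable_lab[OF v]
  have "marginal \<Gamma> unit_borel labeling v
      = distr (iid_uniform \<Gamma>) unit_borel ((bin_value \<circ> (\<lambda>b. lab b v)) \<circ> encode \<Gamma>)"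
    using v by (simp add: marginal_def labeling_def o_def)
  also have "\<dots> = distr (distr (iid_uniform \<Gamma>) law (encode \<Gamma>)) unit_borel (bin_value \<circ> (\<lambda>b. lab b v))"
    by (rule distr_distr[OF measurable_comp[OF lab measurable_bin_value] measurable_encode, symmetric])
  also have "\<dots> = distr law unit_borel (bin_value \<circ> (\<lambda>b. lab b v))"
    by (simp only: distr_encode)
  also have "\<dots> = distr (distr law (coins UNIV) (\<lambda>b. lab b v)) unit_borel bin_value"
    by (rule distr_distr[OF measurable_bin_value lab, symmetric])
  also have "\<dots> = unit_uniform"
    by (simp only: distr_lab[OF v] distr_bin_value)
  finally show ?thesis .
qed

lemma AE_infinite_cluster:
  assumes sym: "symmetric (with_proj T)" and verts: "pverts T = carrier \<Gamma>"
    and arcs: "parcs T \<subseteq> carrier \<Gamma> \<times> carrier \<Gamma>"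
    and inv: "\<And>u v x. (u, v) \<in> parcs T \<Longrightarrow> x \<in> carrier \<Gamma> \<Longrightarrow> (x \<otimes> u, x \<otimes> v) \<in> parcs T"
    and conn: "\<And>k g u. g \<in> S k \<Longrightarrow> u \<in> P k g \<Longrightarrow> (\<one>, u) \<in> (parcs T \<inter> P k g \<times> P k g)\<^sup>*"
  shows "AE \<omega> in iid_uniform \<Gamma>. \<exists>C\<in>clusters T (labeling \<omega>). infinite (verts C)"
proof -
  have "AE b in distr (iid_uniform \<Gamma>) law (encode \<Gamma>). \<exists>k. \<exists>x\<in>carrier \<Gamma>. good b k x"
    unfolding distr_encode by (rule AE_good)
  then have "AE \<omega> in iid_uniform \<Gamma>. \<exists>k. \<exists>x\<in>carrier \<Gamma>. good (encode \<Gamma> \<omega>) k x"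
    by (rule AE_distrD[OF measurable_encode])
  then show ?thesis
  proof eventually_elim
    case (elim \<omega>)
    let ?b = "encode \<Gamma> \<omega>"
    obtain k x where x: "x \<in> carrier \<Gamma>" "good ?b k x" using elim by blast
    \<comment> \<open>Equal digit sequences have equal values. Different sequences may coincide as
      reals, which only enlarges clusters.\<close>
    have sub: "{(u, w) \<in> parcs T. lab ?b u = lab ?b w} \<subseteq> {(u, w) \<in> parcs T. labeling \<omega> u = labeling \<omega> w}"
      using arcs by (auto simp: labeling_def)
    show ?case
    proof (rule infinite_cluster[OF sym _ _ infinite_chain_segs[OF x(1), of k ?b]])
      show "parcs T \<subseteq> pverts T \<times> pverts T" "x \<in> pverts T" using verts arcs x by auto
      fix u assume "u \<in> (\<Union>i. seg ?b (k + i) (chain ?b k x i))"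
      then have "(x, u) \<in> {(u, w) \<in> parcs T. lab ?b u = lab ?b w}\<^sup>*"
        using chain_connected[OF inv conn x] by blast
      then show "(x, u) \<in> {(u, w) \<in> parcs T. labeling \<omega> u = labeling \<omega> w}\<^sup>*"
        using rtrancl_mono[OF sub] by blast
    qed
  qed
qed

end

lemma cayley_graph_left_invariant:
  assumes "group G" "A \<subseteq> carrier G" "(u, v) \<in> parcs (cayley_graph G A)" "x \<in> carrier G"
  shows "(x \<otimes>\<^bsub>G\<^esub> u, x \<otimes>\<^bsub>G\<^esub> v) \<in> parcs (cayley_graph G A)"
proof -
  interpret group G by fact
  obtain s where uv: "u \<in> carrier G" "v \<in> carrier G" and s: "s \<in> A" "v = u \<otimes>\<^bsub>G\<^esub> s \<or> u = v \<otimes>\<^bsub>G\<^esub> s"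
    using assms(3) by (auto simp: cayley_graph_def)
  have "s \<in> carrier G" using s(1) assms(2) by blast
  then have "x \<otimes>\<^bsub>G\<^esub> v = x \<otimes>\<^bsub>G\<^esub> u \<otimes>\<^bsub>G\<^esub> s \<or> x \<otimes>\<^bsub>G\<^esub> u = x \<otimes>\<^bsub>G\<^esub> v \<otimes>\<^bsub>G\<^esub> s"
    using s(2) uv assms(4) by (auto simp: m_assoc)
  then show ?thesis using uv assms(4) s(1) by (auto simp: cayley_graph_def)
qed

theorem theorem1p1:
  fixes \<Gamma> :: "('g, 'm) monoid_scheme" and A :: "'g set"
  assumes "group \<Gamma>" and "countable (carrier \<Gamma>)" and "A \<subseteq> carrier \<Gamma>"
    and "regular_tree 3 (cayley_graph \<Gamma> A)"
  shows "\<exists>\<Theta> :: ('g \<Rightarrow> real) \<Rightarrow> 'g \<Rightarrow> real.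
    FIID_labeling \<Gamma> unit_borel \<Theta> \<and>
    (\<forall>\<gamma>\<in>carrier \<Gamma>. marginal \<Gamma> unit_borel \<Theta> \<gamma> = unit_uniform) \<and>
    (AE \<omega> in iid_uniform \<Gamma>.
      \<exists>C\<in>clusters (cayley_graph \<Gamma> A) (\<Theta> \<omega>). infinite (verts C))"
proof -
  interpret group \<Gamma> by fact
  let ?T = "cayley_graph \<Gamma> A"
  have verts: "pverts ?T = carrier \<Gamma>" by (simp add: cayley_graph_def)
  \<comment> \<open>Packaged as one predicate, so that \<open>S\<close> and \<open>P\<close> can be
    chosen jointly as functions of \<open>k\<close>.\<close>
  define Q where "Q k S P \<longleftrightarrow> finite S \<and> card S = 2 ^ scale k \<and> S \<subseteq> pverts ?T \<and>
    (\<forall>g\<in>S. P g \<subseteq> pverts ?T \<and> finite (P g) \<and> card (P g) = Suc (scale k) \<and>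
      \<one>\<^bsub>\<Gamma>\<^esub> \<in> P g \<and> g \<in> P g \<and> (\<forall>u\<in>P g. (\<one>\<^bsub>\<Gamma>\<^esub>, u) \<in> (parcs ?T \<inter> P g \<times> P g)\<^sup>*))" for k S P
  have "\<forall>k. \<exists>S P. Q k S P"
    using regular_tree_paths[OF assms(4), of "\<one>\<^bsub>\<Gamma>\<^esub>"] verts unfolding Q_def by simp
  then obtain S P where "\<And>k. Q k (S k) (P k)" by metis
  then have SP: "finite (S k) \<and> card (S k) = 2 ^ scale k \<and> S k \<subseteq> carrier \<Gamma> \<and>
    (\<forall>g\<in>S k. P k g \<subseteq> carrier \<Gamma> \<and> finite (P k g) \<and> card (P k g) = Suc (scale k) \<and>
      \<one>\<^bsub>\<Gamma>\<^esub> \<in> P k g \<and> g \<in> P k g \<and> (\<forall>u\<in>P k g. (\<one>\<^bsub>\<Gamma>\<^esub>, u) \<in> (parcs ?T \<inter> P k g \<times> P k g)\<^sup>*))" for k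
    unfolding Q_def verts .
  interpret path_system \<Gamma> S P
  proof unfold_locales
    show "countable (carrier \<Gamma>)" by fact
    fix k
    show "S k \<subseteq> carrier \<Gamma>" "finite (S k)" "card (S k) = 2 ^ scale k" using SP[of k] by simp_all
    fix g assume "g \<in> S k"
    then show "P k g \<subseteq> carrier \<Gamma>" "finite (P k g)" "card (P k g) = Suc (scale k)"
      "\<one>\<^bsub>\<Gamma>\<^esub> \<in> P k g" "g \<in> P k g"
      using SP[of k] by blast+
  qed
  have sym: "symmetric (with_proj ?T)"
    using assms(4) unfolding regular_tree_def pair_bidirected_digraph_def
    by (blast intro: pair_sym_digraph.pair_sym_arcs)
  have "AE \<omega> in iid_uniform \<Gamma>. \<exists>C\<in>clusters ?T (labeling \<omega>). infinite (verts C)"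
  proof (rule AE_infinite_cluster[OF sym verts])
    show "parcs ?T \<subseteq> carrier \<Gamma> \<times> carrier \<Gamma>" by (auto simp: cayley_graph_def)
    show "(x \<otimes>\<^bsub>\<Gamma>\<^esub> u, x \<otimes>\<^bsub>\<Gamma>\<^esub> v) \<in> parcs ?T" if "(u, v) \<in> parcs ?T" "x \<in> carrier \<Gamma>" for u v x
      using cayley_graph_left_invariant[OF assms(1,3) that] .
    show "(\<one>\<^bsub>\<Gamma>\<^esub>, u) \<in> (parcs ?T \<inter> P k g \<times> P k g)\<^sup>*" if "g \<in> S k" "u \<in> P k g" for k g u
      using SP[of k] that by blast
  qed
  then show ?thesis
    using FIID_labeling_labeling marginal_labeling by blast
qed

end
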